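(* Let $\mathcal H$ be a real Hilbert space, $\gamma>0$, $\beta\ge0$. Let $f\in C^1(\mathcal H)$ be real-valued with $\inf_{\mathcal H}f>-\infty$ and $\nabla f$ globally $L$-Lipschitz continuous for some $L\ge0$. Let $\phi:\mathcal H\to\mathbb R\cup\{+\infty\}$ be proper, lower semicontinuous and convex with $\phi(0)=\min\phi=0$ and $r\mathbb B\subseteq\partial\phi(0)$ for some $r>0$. Let $x_0\in\mathcal H$, $v_0\in\mathrm{Dom}(\partial\phi)$, and let $(x,v)$, $v=\dot x$, be the global strong solution of $$\ddot x(t)+\gamma\dot x(t)+\partial\phi(\dot x(t))+\nabla f(x(t)+\beta\dot x(t))\ni 0,\quad t\ge0,\qquad x(0)=x_0,\ \dot x(0)=v_0.$$ For $h>0$ let $(x_k^h,v_k^h)_{k\ge0}$ be generated from $(x_0^h,v_0^h)=(x_0,v_0)$ by $$\frac{v_{k+1}^h-v_k^h}{h}+\gamma v_{k+1}^h+\partial\phi(v_{k+1}^h)+\nabla f(x_k^h+\beta v_k^h)\ni0,\qquad \frac{x_{k+1}^h-x_k^h}{h}=v_{k+1}^h,$$ let $(x_h,v_h)$ be the piecewise affine interpolants, i.e. with $t_k=kh$, for $t\in[t_k,t_{k+1}]$, $x_h(t)=x_k^h+(t-t_k)v_{k+1}^h$ and $v_h(t)=v_k^h+(t-t_k)\frac{v_{k+1}^h-v_k^h}{h}$, and let $K_{\mathrm{stop}}^h=\inf\{K\in\mathbb N: v_k^h=0\text{ for every }k\ge K\}$ (with $\inf\varnothing=+\infty$). Suppose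 that the continuous trajectory has a finite permanent stopping time $T_{\mathrm{stop}}>0$ and that for some $\delta>0$ $$-\nabla f(x(T_{\mathrm{stop}}))+\delta\mathbb B\subseteq\partial\phi(0).$$ Then $K_{\mathrm{stop}}^h<+\infty$ for every sufficiently small $h$. Moreover there exist $C>0$ and $h_0>0$ such that for every $0<h\le h_0$ $$\left|hK_{\mathrm{stop}}^h-T_{\mathrm{stop}}\right|+\left\|x^h_{K_{\mathrm{stop}}^h}-x(T_{\mathrm{stop}})\right\|\le C\sqrt h$$ (in particular $hK_{\mathrm{stop}}^h\to T_{\mathrm{stop}}$ and $x^h_{K_{\mathrm{stop}}^h}\to x(T_{\mathrm{stop}})$ as $h\downarrow0$), and $$\sup_{t\ge0}\left(\|x_h(t)-x(t)\|+\|v_h(t)-v(t)\|\right)\le C\sqrt h .$$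
   Context: $\mathbb B$ is the closed unit ball; $\partial\phi$ is the convex subdifferential and $\mathrm{Dom}(\partial\phi)=\{v:\partial\phi(v)\ne\varnothing\}$. A strong solution on $[0,T]$ is a pair $(x,v)$ with $x,v\in W^{1,2}(0,T;\mathcal H)$, $v=\dot x$ a.e., $x(0)=x_0$, $v(0)=v_0$, and some $\xi\in L^2(0,T;\mathcal H)$ with $\xi(t)\in\partial\phi(v(t))$ and $\dot v+\gamma v+\xi+\nabla f(x+\beta v)=0$ a.e. on $(0,T)$; a global strong solution is one whose restriction to every $[0,T]$ is strong (it exists and is unique here). The permanent stopping time is $T_{\mathrm{stop}}=\inf\{T\ge0:v(t)=0\text{ for every }t\ge T\}$. The discrete recursion is uniquely solvable: $v_{k+1}^h=\mathrm{prox}_{\lambda_h\phi}\bigl(\frac{1}{1+h\gamma}v_k^h-\lambda_h\nabla f(x_k^h+\beta v_k^h)\bigr)$, $\lambda_h=\frac{h}{1+h\gamma}$. *)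

theory Defs
  imports "HOL-Analysis.Analysis"
begin

text \<open>
  Real Hilbert spaces are types of sort \<open>{real_inner, complete_space}\<close>; no separability is assumed.
\<close>

section \<open>Convex analysis for extended-real-valued functions\<close>

definition proper_fun :: "('a \<Rightarrow> ereal) \<Rightarrow> bool" where
  "proper_fun \<phi> \<longleftrightarrow> (\<forall>x. \<phi> x \<noteq> -\<infinity>) \<and> (\<exists>x. \<phi> x < \<infinity>)"

definition lsc_fun :: "('a::topological_space \<Rightarrow> ereal) \<Rightarrow> bool" where
  "lsc_fun \<phi> \<longleftrightarrow> (\<forall>x. \<phi> x \<le> Liminf (at x) \<phi>)"

definition convex_fun :: "('a::real_vector \<Rightarrow> ereal) \<Rightarrow> bool" where
  "convex_fun \<phi> \<longleftrightarrow>
     (\<forall>x y. \<forall>t\<in>{0..1::real}.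
        \<phi> ((1 - t) *\<^sub>R x + t *\<^sub>R y) \<le> ereal (1 - t) * \<phi> x + ereal t * \<phi> y)"

text \<open>For proper \<open>\<phi>\<close> this is empty wherever \<open>\<phi> v = \<infinity>\<close>.\<close>

definition subdiff :: "('a::real_inner \<Rightarrow> ereal) \<Rightarrow> 'a \<Rightarrow> 'a set" where
  "subdiff \<phi> v = {\<xi>. \<forall>w. \<phi> v + ereal (inner \<xi> (w - v)) \<le> \<phi> w}"

definition Dom_subdiff :: "('a::real_inner \<Rightarrow> ereal) \<Rightarrow> 'a set" where
  "Dom_subdiff \<phi> = {v. subdiff \<phi> v \<noteq> {}}"

section \<open>The spaces \<open>L\<^sup>2(0,T;H)\<close> and \<open>W\<^sup>1\<^sup>,\<^sup>2(0,T;H)\<close>\<close>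

text \<open>
  The library's Bochner integral requires a second countable target space. Since \<open>H\<close> may be
  non-separable, strong (Bochner) measurability is spelled out, and the integral is the
  Henstock--Kurzweil one, which agrees with the Bochner integral on Bochner integrable functions.
\<close>

definition strongly_measurable :: "'b measure \<Rightarrow> ('b \<Rightarrow> 'a::topological_space) \<Rightarrow> bool" where
  "strongly_measurable M g \<longleftrightarrow>
     (\<exists>s. (\<forall>i::nat. simple_function M (s i)) \<and> (AE t in M. (\<lambda>i. s i t) \<longlonglongrightarrow> g t))"

definition L2 :: "real \<Rightarrow> (real \<Rightarrow> 'a::real_normed_vector) set" where
  "L2 T = {g. strongly_measurable (lebesgue_on {0<..<T}) g \<and>
              integrable (lebesgue_on {0<..<T}) (\<lambda>t. (norm (g t))\<^sup>2)}"

text \<open>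
  \<open>has_W12_deriv T u g\<close>: \<open>u\<close> is the continuous representative of an element of
  \<open>W\<^sup>1\<^sup>,\<^sup>2(0,T;H)\<close>, and \<open>g\<close> represents its derivative. Hence \<open>u 0\<close> is the trace at \<open>0\<close>.
\<close>

definition has_W12_deriv ::
    "real \<Rightarrow> (real \<Rightarrow> 'a::real_normed_vector) \<Rightarrow> (real \<Rightarrow> 'a) \<Rightarrow> bool" where
  "has_W12_deriv T u g \<longleftrightarrow>
     g \<in> L2 T \<and> (\<forall>t\<in>{0..T}. (g has_integral (u t - u 0)) {0..t})"

section \<open>Strong solutions\<close>

definition strong_solution ::
    "('a::real_inner \<Rightarrow> 'a) \<Rightarrow> ('a \<Rightarrow> ereal) \<Rightarrow> real \<Rightarrow> real \<Rightarrow> 'a \<Rightarrow> 'a \<Rightarrow> real \<Rightarrow>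
     (real \<Rightarrow> 'a) \<Rightarrow> (real \<Rightarrow> 'a) \<Rightarrow> bool" where
  "strong_solution gradf \<phi> \<gamma> \<beta> x0 v0 T x v \<longleftrightarrow>
     (\<exists>x' v' \<xi>.
        has_W12_deriv T x x' \<and> has_W12_deriv T v v' \<and>
        (AE t in lebesgue_on {0<..<T}. v t = x' t) \<and>
        x 0 = x0 \<and> v 0 = v0 \<and>
        \<xi> \<in> L2 T \<and>
        (AE t in lebesgue_on {0<..<T}. \<xi> t \<in> subdiff \<phi> (v t)) \<and>
        (AE t in lebesgue_on {0<..<T}.
           v' t + \<gamma> *\<^sub>R v t + \<xi> t + gradf (x t + \<beta> *\<^sub>R v t) = 0))"

definition global_strong_solution ::
    "('a::real_inner \<Rightarrow> 'a) \<Rightarrow> ('a \<Rightarrow> ereal) \<Rightarrow> real \<Rightarrow> real \<Rightarrow> 'a \<Rightarrow> 'a \<Rightarrow>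
     (real \<Rightarrow> 'a) \<Rightarrow> (real \<Rightarrow> 'a) \<Rightarrow> bool" where
  "global_strong_solution gradf \<phi> \<gamma> \<beta> x0 v0 x v \<longleftrightarrow>
     (\<forall>T>0. strong_solution gradf \<phi> \<gamma> \<beta> x0 v0 T x v)"

definition stop_time :: "(real \<Rightarrow> 'a::zero) \<Rightarrow> ereal" where
  "stop_time v = Inf (ereal ` {T. 0 \<le> T \<and> (\<forall>t\<ge>T. v t = 0)})"

section \<open>The discrete scheme\<close>

definition discrete_scheme ::
    "('a::real_inner \<Rightarrow> 'a) \<Rightarrow> ('a \<Rightarrow> ereal) \<Rightarrow> real \<Rightarrow> real \<Rightarrow> 'a \<Rightarrow> 'a \<Rightarrow> real \<Rightarrow>
     (nat \<Rightarrow> 'a) \<Rightarrow> (nat \<Rightarrow> 'a) \<Rightarrow> bool" where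
  "discrete_scheme gradf \<phi> \<gamma> \<beta> x0 v0 h X V \<longleftrightarrow>
     X 0 = x0 \<and> V 0 = v0 \<and>
     (\<forall>k. (\<exists>\<xi>\<in>subdiff \<phi> (V (Suc k)).
             (V (Suc k) - V k) /\<^sub>R h + \<gamma> *\<^sub>R V (Suc k) + \<xi> + gradf (X k + \<beta> *\<^sub>R V k) = 0) \<and>
          (X (Suc k) - X k) /\<^sub>R h = V (Suc k))"

definition stop_index :: "(nat \<Rightarrow> 'a::zero) \<Rightarrow> enat" where
  "stop_index V = Inf (enat ` {K. \<forall>k\<ge>K. V k = 0})"

text \<open>
  The function equal to \<open>u k + (t - k h) s k\<close> on \<open>[k h, (k + 1) h)\<close>. The formula extends to the
  closed interval as soon as the nodal values \<open>u\<close> and slopes \<open>s\<close> are compatible.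
\<close>

definition pw_affine :: "real \<Rightarrow> (nat \<Rightarrow> 'a::real_vector) \<Rightarrow> (nat \<Rightarrow> 'a) \<Rightarrow> real \<Rightarrow> 'a" where
  "pw_affine h u s t = (let k = nat \<lfloor>t / h\<rfloor> in u k + (t - real k * h) *\<^sub>R s k)"

definition interp_x :: "real \<Rightarrow> (nat \<Rightarrow> 'a::real_vector) \<Rightarrow> (nat \<Rightarrow> 'a) \<Rightarrow> real \<Rightarrow> 'a" where
  "interp_x h X V = pw_affine h X (\<lambda>k. V (Suc k))"

definition interp_v :: "real \<Rightarrow> (nat \<Rightarrow> 'a::real_vector) \<Rightarrow> real \<Rightarrow> 'a" where
  "interp_v h V = pw_affine h V (\<lambda>k. (V (Suc k) - V k) /\<^sub>R h)"

lemma pw_affine_eq: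
  assumes "h > 0" and "u (Suc k) = u k + h *\<^sub>R s k"
    and "real k * h \<le> t" and "t \<le> real (Suc k) * h"
  shows "pw_affine h u s t = u k + (t - real k * h) *\<^sub>R s k"
proof (cases "t = real (Suc k) * h")
  case True
  then have "nat \<lfloor>t / h\<rfloor> = Suc k"
    using assms(1) by (metis floor_of_nat nat_int nonzero_mult_div_cancel_right less_irrefl)
  moreover have "t - real k * h = h"
    using True by (simp add: algebra_simps)
  ultimately show ?thesis
    using True assms(2) by (simp add: pw_affine_def)
next
  case False
  then have "real k \<le> t / h" "t / h < real k + 1"
    using assms by (auto simp: field_simps)
  then have "\<lfloor>t / h\<rfloor> = int k"
    by (intro floor_unique) auto
  then show ?thesis
    by (simp add: pw_affine_def)
qed

lemma interp_x_eq:
  assumes "discrete_scheme gradf \<phi> \<gamma> \<beta> x0 v0 h X V" and "h > 0"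
    and "real k * h \<le> t" and "t \<le> real (Suc k) * h"
  shows "interp_x h X V t = X k + (t - real k * h) *\<^sub>R V (Suc k)"
proof -
  have "V (Suc k) = (X (Suc k) - X k) /\<^sub>R h"
    using assms(1) by (simp add: discrete_scheme_def)
  then have "X (Suc k) = X k + h *\<^sub>R V (Suc k)"
    using assms(2) by simp
  then show ?thesis
    unfolding interp_x_def by (intro pw_affine_eq assms)
qed

lemma interp_v_eq:
  assumes "h > 0" and "real k * h \<le> t" and "t \<le> real (Suc k) * h"
  shows "interp_v h V t = V k + (t - real k * h) *\<^sub>R ((V (Suc k) - V k) /\<^sub>R h)"
  unfolding interp_v_def using assms by (intro pw_affine_eq) auto

end

(*
  Since v0 lies in the domain of the subdifferential, monotonicity bounds the discrete accelerations
  on bounded time intervals. Testing the difference of the two inclusions with the error then gives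
  an energy estimate of order h, in which monotonicity leaves only the product of the O(h) distance
  between interpolant and node with the integrable selections; hence the rate sqrt h on [0, T_stop + 1].
  By the margin condition, as long as the position is close to x(T_stop) and the velocity is small,
  the speed of either dynamics decreases at least at rate delta / 2 until it vanishes, after which the
  motion is frozen. Applied to the scheme after T_stop this bounds h K_stop from above; applied to the
  solution after h K_stop it bounds it from below. Both speeds being O(sqrt h) at these times, the two
  stopping times differ by O(sqrt h), and after T_stop + 1 both trajectories are constant.
*)
theory Submission
  imports Defs
begin

section \<open>Primitives in the weak sense\<close>

text \<open>Both extinction arguments need a position close to x(T_stop). After T_stop the error
  estimate supplies it, since the solution rests there. Before T_stop the solution could a priori
  still travel far. If the scheme stops at a node K with K h < T_stop, however, its position is
  final, hence equal to a node position past T_stop, and so within O(sqrt h) of x(T_stop). The error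
  estimate carries this over to the solution on all of [K h, T_stop]. This is why the upper bound
  for the stopping index comes first and the lower bound relies on it. The margin ball of radius
  delta is split into two halves: one absorbs the deviation of the force from its value at
  x(T_stop), the other is the net deceleration.\<close>

text \<open>
  A type of sort \<open>{real_inner, complete_space}\<close> is not recognised as an instance of \<open>banach\<close>, so
  integrals of vector-valued functions cannot be restricted to subintervals with the library
  lemmas. Testing against fixed vectors makes every integral scalar.
\<close>

definition weak_primitive ::
    "real \<Rightarrow> real \<Rightarrow> (real \<Rightarrow> 'a::real_inner) \<Rightarrow> (real \<Rightarrow> 'a) \<Rightarrow> bool" where
  "weak_primitive a b u g \<longleftrightarrow>
     (\<forall>s t c. a \<le> s \<and> s \<le> t \<and> t \<le> b \<longrightarrow>
        ((\<lambda>\<tau>. g \<tau> \<bullet> c) has_integral ((u t - u s) \<bullet> c)) {s..t})"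

lemma weak_primitiveD:
  assumes "weak_primitive a b u g" "a \<le> s" "s \<le> t" "t \<le> b"
  shows "((\<lambda>\<tau>. g \<tau> \<bullet> c) has_integral ((u t - u s) \<bullet> c)) {s..t}"
  using assms by (auto simp: weak_primitive_def)

lemma weak_primitive_subinterval:
  assumes "weak_primitive a b u g" "a \<le> a'" "b' \<le> b"
  shows "weak_primitive a' b' u g"
  using assms by (auto simp: weak_primitive_def)

lemma weak_primitiveI:
  assumes "\<And>t c. a \<le> t \<Longrightarrow> t \<le> b \<Longrightarrow> ((\<lambda>\<tau>. g \<tau> \<bullet> c) has_integral ((u t - u a) \<bullet> c)) {a..t}"
  shows "weak_primitive a b u g"
  unfolding weak_primitive_def
proof (intro allI impI, elim conjE)
  fix s t c assume st: "a \<le> s" "s \<le> t" "t \<le> b"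
  let ?f = "\<lambda>\<tau>. g \<tau> \<bullet> c"
  have 1: "(?f has_integral ((u s - u a) \<bullet> c)) {a..s}" and 2: "(?f has_integral ((u t - u a) \<bullet> c)) {a..t}"
    using assms st by auto
  have i: "?f integrable_on {a..t}" using 2 by blast
  have "integral {a..s} ?f + integral {s..t} ?f = integral {a..t} ?f"
    using Henstock_Kurzweil_Integration.integral_combine[OF st(1,2) i] .
  then have "integral {s..t} ?f = (u t - u s) \<bullet> c"
    using integral_unique[OF 1] integral_unique[OF 2] by (simp add: inner_diff_left)
  moreover have "?f integrable_on {s..t}"
    by (rule integrable_subinterval_real[OF i]) (use st in auto)
  ultimately show "(?f has_integral ((u t - u s) \<bullet> c)) {s..t}"
    by (metis integrable_integral)
qed

lemma weak_primitive_of_has_integral: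
  assumes "\<forall>t\<in>{0..T}. (g has_integral (u t - u 0)) {0..t}"
  shows "weak_primitive 0 T u g"
proof (rule weak_primitiveI)
  fix t c assume "0 \<le> t" "t \<le> T"
  then have "(g has_integral (u t - u 0)) {0..t}" using assms by auto
  from has_integral_linear[OF this bounded_linear_inner_left[of c]]
  show "((\<lambda>\<tau>. g \<tau> \<bullet> c) has_integral ((u t - u 0) \<bullet> c)) {0..t}" by (simp add: o_def)
qed

lemma weak_primitive_spike:
  assumes "weak_primitive a b u g" "negligible N" "\<And>t. t \<in> {a..b} - N \<Longrightarrow> g' t = g t"
  shows "weak_primitive a b u g'"
  unfolding weak_primitive_def
proof (intro allI impI, elim conjE)
  fix s t c assume st: "a \<le> s" "s \<le> t" "t \<le> b"
  show "((\<lambda>\<tau>. g' \<tau> \<bullet> c) has_integral ((u t - u s) \<bullet> c)) {s..t}"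
    by (rule has_integral_spike[OF assms(2) _ weak_primitiveD[OF assms(1) st]])
       (use assms(3) st in auto)
qed

lemma weak_primitive_diff:
  assumes "weak_primitive a b u g" "weak_primitive a b u' g'"
  shows "weak_primitive a b (\<lambda>t. u t - u' t) (\<lambda>t. g t - g' t)"
  unfolding weak_primitive_def
proof (intro allI impI, elim conjE)
  fix s t c assume st: "a \<le> s" "s \<le> t" "t \<le> b"
  show "((\<lambda>\<tau>. (g \<tau> - g' \<tau>) \<bullet> c) has_integral ((u t - u' t - (u s - u' s)) \<bullet> c)) {s..t}"
    using has_integral_diff[OF weak_primitiveD[OF assms(1) st, of c] weak_primitiveD[OF assms(2) st, of c]]
    by (simp add: inner_diff_left algebra_simps)
qed

section \<open>Norm bounds, continuity and the chain rule for weak primitives\<close>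

lemma has_integral_le_negligible:
  fixes f g :: "real \<Rightarrow> real"
  assumes f: "(f has_integral i) S" and g: "(g has_integral j) S"
    and N: "negligible N" and le: "\<And>x. x \<in> S - N \<Longrightarrow> f x \<le> g x"
  shows "i \<le> j"
proof -
  have "((\<lambda>x. if x \<in> N then f x else g x) has_integral j) S"
    by (rule has_integral_spike[OF N _ g]) auto
  from has_integral_le[OF f this] show ?thesis using le by auto
qed

text \<open>Testing with the increment \<open>u t - u s\<close> itself produces its squared norm,
  and one factor cancels. The majorant \<open>n\<close> stands in for
  \<open>norm (g \<tau>)\<close>, whose integrability is not part of a weak primitive.\<close>

lemma weak_primitive_norm_le:
  assumes g: "weak_primitive a b u g" and n: "n integrable_on {a..b}" and N: "negligible N"
    and le: "\<And>\<tau>. \<tau> \<in> {a..b} - N \<Longrightarrow> norm (g \<tau>) \<le> n \<tau>"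
    and st: "a \<le> s" "s \<le> t" "t \<le> b"
  shows "norm (u t - u s) \<le> integral {s..t} n"
proof (cases "u t = u s")
  case True
  have "0 \<le> integral {s..t} n"
  proof (rule has_integral_le_negligible[OF has_integral_0 _ N])
    show "(n has_integral integral {s..t} n) {s..t}"
      using n st by (intro integrable_integral integrable_subinterval_real[OF n]) auto
    show "0 \<le> n x" if "x \<in> {s..t} - N" for x
      using order_trans[OF norm_ge_zero le[of x]] that st by auto
  qed
  then show ?thesis using True by simp
next
  case False
  let ?w = "u t - u s"
  have n': "n integrable_on {s..t}"
    using n st by (intro integrable_subinterval_real[OF n]) auto
  have "?w \<bullet> ?w \<le> integral {s..t} n * norm ?w"
  proof (rule has_integral_le_negligible[OF weak_primitiveD[OF g st] _ N])
    show "((\<lambda>\<tau>. n \<tau> * norm ?w) has_integral integral {s..t} n * norm ?w) {s..t}"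
      using n' by (intro has_integral_mult_left integrable_integral)
    fix \<tau> assume "\<tau> \<in> {s..t} - N"
    then have "norm (g \<tau>) \<le> n \<tau>" using le st by auto
    then show "g \<tau> \<bullet> ?w \<le> n \<tau> * norm ?w"
      using norm_cauchy_schwarz[of "g \<tau>" ?w] mult_right_mono[of "norm (g \<tau>)" "n \<tau>" "norm ?w"]
      by auto
  qed
  then have "norm ?w * norm ?w \<le> integral {s..t} n * norm ?w"
    by (simp add: power2_norm_eq_inner[symmetric] power2_eq_square)
  then show ?thesis using False by simp
qed

text \<open>Increments of \<open>u\<close> are dominated by those of the indefinite integral of
  \<open>n\<close>, which is continuous.\<close>

lemma weak_primitive_continuous:
  assumes g: "weak_primitive a b u g" and n: "n integrable_on {a..b}" and N: "negligible N"
    and le: "\<And>\<tau>. \<tau> \<in> {a..b} - N \<Longrightarrow> norm (g \<tau>) \<le> n \<tau>"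
  shows "continuous_on {a..b} u"
proof -
  let ?I = "\<lambda>t. integral {a..t} n"
  have I: "continuous_on {a..b} ?I"
    by (rule indefinite_integral_continuous_1[OF n])
  have dist_le: "dist (u t) (u s) \<le> dist (?I t) (?I s)" if "s \<in> {a..b}" "t \<in> {a..b}" for s t
  proof -
    have *: "dist (u t) (u s) \<le> dist (?I t) (?I s)" if "a \<le> s" "s \<le> t" "t \<le> b" for s t
    proof -
      have "n integrable_on {a..t}"
        using that by (intro integrable_subinterval_real[OF n]) auto
      from Henstock_Kurzweil_Integration.integral_combine[OF that(1,2) this]
      have "integral {s..t} n = ?I t - ?I s" by simp
      then show ?thesis
        using weak_primitive_norm_le[OF g n N le that] by (simp add: dist_norm)
    qed
    show ?thesis
    proof (cases "s \<le> t")
      case True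
      then show ?thesis using * that by auto
    next
      case False
      then show ?thesis using *[of t s] that by (auto simp: dist_commute)
    qed
  qed
  show ?thesis
    unfolding continuous_on_iff
  proof (intro ballI allI impI)
    fix s \<epsilon> assume s: "s \<in> {a..b}" and "(0::real) < \<epsilon>"
    then obtain d where "d > 0" and d: "\<And>t. t \<in> {a..b} \<Longrightarrow> dist t s < d \<Longrightarrow> dist (?I t) (?I s) < \<epsilon>"
      using I unfolding continuous_on_iff by meson
    then show "\<exists>d>0. \<forall>x'\<in>{a..b}. dist x' s < d \<longrightarrow> dist (u x') (u s) < \<epsilon>"
      using dist_le s by (meson le_less_trans)
  qed
qed

text \<open>
  With \<open>\<Psi> = \<psi> \<circ> u\<close> for a convex \<open>\<psi>\<close> and \<open>p t\<close> a subgradient of \<open>\<psi>\<close> at \<open>u t\<close>, this is the chain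
  rule \<open>\<Psi>' = g \<bullet> p \<le> m\<close> in integrated form; no measurability of \<open>g \<bullet> p\<close> is involved.
\<close>

lemma weak_primitive_chain_le:
  fixes \<Psi> m n :: "real \<Rightarrow> real"
  assumes ab: "a \<le> b" and g: "weak_primitive a b u g"
    and p: "continuous_on {a..b} p"
    and sub: "\<And>s t. a \<le> s \<Longrightarrow> s \<le> t \<Longrightarrow> t \<le> b \<Longrightarrow> \<Psi> t - \<Psi> s \<le> (u t - u s) \<bullet> p t"
    and m: "m integrable_on {a..b}" and n: "n integrable_on {a..b}" and N: "negligible N"
    and gp: "\<And>\<tau>. \<tau> \<in> {a..b} - N \<Longrightarrow> g \<tau> \<bullet> p \<tau> \<le> m \<tau>"
    and gn: "\<And>\<tau>. \<tau> \<in> {a..b} - N \<Longrightarrow> norm (g \<tau>) \<le> n \<tau>"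
  shows "\<Psi> b - \<Psi> a \<le> integral {a..b} m"
proof -
  \<comment> \<open>On cells shorter than \<open>d\<close>, \<open>p\<close> differs from its value
    at the right end by less than \<epsilon>. Freezing it there costs at most
    \<open>\<epsilon> * n\<close>, and the cell estimates telescope.\<close>
  have eps: "\<Psi> b - \<Psi> a \<le> integral {a..b} m + \<epsilon> * integral {a..b} n" if e: "\<epsilon> > 0" for \<epsilon>
  proof -
    let ?k = "\<lambda>\<tau>. m \<tau> + \<epsilon> * n \<tau>"
    have k: "?k integrable_on {a..b}"
      using m n by (intro integrable_add integrable_on_mult_right)
    have "uniformly_continuous_on {a..b} p"
      using p by (simp add: compact_uniformly_continuous)
    then obtain d where d: "d > 0" "\<And>s t. s \<in> {a..b} \<Longrightarrow> t \<in> {a..b} \<Longrightarrow> dist t s < d \<Longrightarrow> dist (p t) (p s) < \<epsilon>"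
      using e unfolding uniformly_continuous_on_def by meson
    have step: "\<Psi> t - \<Psi> s \<le> integral {s..t} ?k" if st: "a \<le> s" "s \<le> t" "t \<le> b" "t - s < d" for s t
    proof -
      have "(u t - u s) \<bullet> p t \<le> integral {s..t} ?k"
      proof (rule has_integral_le_negligible[OF weak_primitiveD[OF g st(1-3)] _ N])
        show "(?k has_integral integral {s..t} ?k) {s..t}"
          using st by (intro integrable_integral integrable_subinterval_real[OF k]) auto
        fix \<tau> assume \<tau>: "\<tau> \<in> {s..t} - N"
        then have \<tau>': "\<tau> \<in> {a..b} - N" using st by auto
        have "dist (p t) (p \<tau>) < \<epsilon>" using \<tau> st by (intro d(2)) (auto simp: dist_real_def)
        then have "g \<tau> \<bullet> (p t - p \<tau>) \<le> n \<tau> * \<epsilon>"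
          using gn[OF \<tau>'] e by (intro order_trans[OF norm_cauchy_schwarz] mult_mono)
             (auto simp: dist_norm intro: order_trans[OF norm_ge_zero])
        then show "g \<tau> \<bullet> p t \<le> ?k \<tau>"
          using gp[OF \<tau>'] by (simp add: inner_diff_right algebra_simps)
      qed
      then show ?thesis using sub[OF st(1-3)] by linarith
    qed
    obtain M :: nat where M: "(b - a) / d < real M" using reals_Archimedean2 by blast
    then have M0: "real M > 0" using d(1) ab by (smt (verit) divide_nonneg_pos)
    define q where "q i = a + real i * ((b - a) / real M)" for i
    have q_step: "q (Suc i) - q i = (b - a) / real M" for i
      by (simp add: q_def distrib_right add_divide_distrib)
    have small: "(b - a) / real M < d" using M M0 d(1) by (simp add: field_simps)
    have q0: "a \<le> q i" for i using ab by (simp add: q_def)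
    have qM: "q i \<le> b" if "i \<le> M" for i
    proof -
      have "real i * (b - a) \<le> real M * (b - a)" using that ab by (intro mult_right_mono) auto
      then show ?thesis using M0 by (simp add: q_def field_simps)
    qed
    have "i \<le> M \<Longrightarrow> \<Psi> (q i) - \<Psi> a \<le> integral {a..q i} ?k" for i
    proof (induction i)
      case 0
      then show ?case by (simp add: q_def)
    next
      case (Suc i)
      have mono: "q i \<le> q (Suc i)" using q_step[of i] ab M0 by (smt (verit) divide_nonneg_pos)
      have "\<Psi> (q (Suc i)) - \<Psi> (q i) \<le> integral {q i..q (Suc i)} ?k"
        using Suc.prems q0 qM mono small q_step[of i] by (intro step) auto
      moreover have "?k integrable_on {a..q (Suc i)}"
        using qM[OF Suc.prems] by (intro integrable_subinterval_real[OF k]) auto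
      ultimately show ?case
        using Suc Henstock_Kurzweil_Integration.integral_combine[OF q0[of i] mono, of ?k] by simp
    qed
    from this[of M] have "\<Psi> b - \<Psi> a \<le> integral {a..b} ?k" using M0 by (simp add: q_def)
    also have "integral {a..b} ?k = integral {a..b} m + \<epsilon> * integral {a..b} n"
      using m n by (subst Henstock_Kurzweil_Integration.integral_add)
        (auto intro!: integrable_on_mult_right)
    finally show ?thesis .
  qed
  show ?thesis
  proof (rule field_le_epsilon)
    fix \<epsilon> :: real assume e: "\<epsilon> > 0"
    define c where "c = \<bar>integral {a..b} n\<bar> + 1"
    have c: "c > 0" by (simp add: c_def)
    have "\<epsilon> / c * integral {a..b} n \<le> \<epsilon> / c * c"
      using e c by (intro mult_left_mono) (auto simp: c_def)
    then show "\<Psi> b - \<Psi> a \<le> integral {a..b} m + \<epsilon>"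
      using eps[of "\<epsilon> / c"] e c by auto
  qed
qed

text \<open>Chain rule for half the squared norm, where the subgradient at \<open>u t\<close> is
  \<open>u t\<close> itself; the subgradient inequality is the nonnegativity of
  \<open>(norm (u t - u s))\<^sup>2\<close>.\<close>

lemma weak_primitive_half_square_le:
  assumes ab: "a \<le> b" and g: "weak_primitive a b u g"
    and m: "m integrable_on {a..b}" and n: "n integrable_on {a..b}" and N: "negligible N"
    and gm: "\<And>\<tau>. \<tau> \<in> {a..b} - N \<Longrightarrow> g \<tau> \<bullet> u \<tau> \<le> m \<tau>"
    and gn: "\<And>\<tau>. \<tau> \<in> {a..b} - N \<Longrightarrow> norm (g \<tau>) \<le> n \<tau>"
  shows "(norm (u b))\<^sup>2 / 2 - (norm (u a))\<^sup>2 / 2 \<le> integral {a..b} m"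
proof (rule weak_primitive_chain_le[where \<Psi> = "\<lambda>t. (norm (u t))\<^sup>2 / 2", OF ab g _ _ m n N gm gn])
  show "continuous_on {a..b} u" by (rule weak_primitive_continuous[OF g n N gn])
  fix s t
  have "0 \<le> (norm (u t - u s))\<^sup>2" by simp
  then show "(norm (u t))\<^sup>2 / 2 - (norm (u s))\<^sup>2 / 2 \<le> (u t - u s) \<bullet> u t"
    by (simp add: power2_norm_eq_inner inner_diff_left inner_diff_right inner_commute field_simps)
qed

text \<open>Multiplying by \<open>exp (- 2 K t)\<close> turns the integral term into half of the maximum.\<close>

lemma gronwall_integral:
  fixes w :: "real \<Rightarrow> real"
  assumes w: "continuous_on {0..S} w" and K: "K \<ge> 0" and c: "c \<ge> 0"
    and le: "\<And>t. t \<in> {0..S} \<Longrightarrow> w t \<le> c + K * integral {0..t} w"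
    and t: "t \<in> {0..S}"
  shows "w t \<le> 2 * c * exp (2 * K * t)"
proof -
  let ?z = "\<lambda>s. w s * exp (- (2 * K * s))"
  have "continuous_on {0..S} ?z" using w by (intro continuous_intros)
  then obtain s where s: "s \<in> {0..S}" and max: "\<And>y. y \<in> {0..S} \<Longrightarrow> ?z y \<le> ?z s"
    using continuous_attains_sup[of "{0..S}" ?z] t by auto
  \<comment> \<open>The truncation at 0 makes it possible to drop the lower-limit term - M / (2 K)
    even when the maximum is negative.\<close>
  define M where "M = max 0 (?z s)"
  have M0: "M \<ge> 0" by (simp add: M_def)
  have wM: "w y \<le> M * exp (2 * K * y)" if "y \<in> {0..S}" for y
  proof -
    have "?z y \<le> M" using max[OF that] by (simp add: M_def)
    then have "?z y * exp (2 * K * y) \<le> M * exp (2 * K * y)" by (intro mult_right_mono) auto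
    then show ?thesis by (simp add: mult.assoc exp_add[symmetric])
  qed
  have "K * integral {0..s} w \<le> M / 2 * exp (2 * K * s)"
  proof (cases "K = 0")
    case True
    then show ?thesis using M0 by simp
  next
    case False
    then have K': "K > 0" using K by simp
    have 1: "((\<lambda>y. M * exp (2 * K * y)) has_integral
           (M / (2 * K) * exp (2 * K * s) - M / (2 * K) * exp (2 * K * 0))) {0..s}"
      using s K' by (intro fundamental_theorem_of_calculus)
        (auto simp flip: has_real_derivative_iff_has_vector_derivative intro!: derivative_eq_intros)
    have "w integrable_on {0..s}"
      by (rule integrable_continuous_real, rule continuous_on_subset[OF w]) (use s in auto)
    then have "(w has_integral integral {0..s} w) {0..s}" by blast
    from has_integral_le[OF this 1] wM s
    have "integral {0..s} w \<le> M / (2 * K) * exp (2 * K * s) - M / (2 * K)" by auto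
    also have "\<dots> \<le> M / (2 * K) * exp (2 * K * s)" using M0 K' by simp
    finally show ?thesis using K' by (simp add: field_simps)
  qed
  then have "w s \<le> c + M / 2 * exp (2 * K * s)" using le[OF s] by linarith
  then have "?z s \<le> (c + M / 2 * exp (2 * K * s)) * exp (- (2 * K * s))" by (intro mult_right_mono) auto
  also have "\<dots> = c * exp (- (2 * K * s)) + M / 2" by (simp add: algebra_simps exp_add[symmetric])
  also have "\<dots> \<le> c * 1 + M / 2" using c K s by (intro add_right_mono mult_left_mono) auto
  finally have "M \<le> 2 * c" using c by (auto simp: M_def max_def split: if_splits)
  then have "M * exp (2 * K * t) \<le> 2 * c * exp (2 * K * t)" by (intro mult_right_mono) auto
  then show ?thesis using wM[OF t] by linarith
qed

section \<open>Piecewise affine interpolants as weak primitives\<close>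

lemma grid_cell:
  fixes h t :: real
  assumes "0 \<le> t" "h > 0"
  shows "real (nat \<lfloor>t / h\<rfloor>) * h \<le> t" "t \<le> real (Suc (nat \<lfloor>t / h\<rfloor>)) * h"
proof -
  have "real (nat \<lfloor>t / h\<rfloor>) \<le> t / h" "t / h \<le> real (Suc (nat \<lfloor>t / h\<rfloor>))"
    using assms real_of_int_floor_add_one_ge[of "t / h"] by (auto simp: add.commute)
  then show "real (nat \<lfloor>t / h\<rfloor>) * h \<le> t" "t \<le> real (Suc (nat \<lfloor>t / h\<rfloor>)) * h"
    using assms(2) by (simp_all only: pos_le_divide_eq pos_divide_le_eq)
qed

lemma weak_primitive_pw_affine:
  assumes h: "h > 0" and us: "\<And>k. u (Suc k) = u k + h *\<^sub>R s k"
  shows "weak_primitive 0 T (pw_affine h u s) (\<lambda>\<tau>. s (nat \<lfloor>\<tau> / h\<rfloor>))"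
proof (rule weak_primitiveI)
  fix t c assume "0 \<le> t" "t \<le> T"
  let ?f = "\<lambda>\<tau>. s (nat \<lfloor>\<tau> / h\<rfloor>) \<bullet> c"
  have cell: "(?f has_integral ((pw_affine h u s t - u k) \<bullet> c)) {real k * h..t}"
    if t: "real k * h \<le> t" "t \<le> real (Suc k) * h" for t k
  proof (rule has_integral_spike)
    \<comment> \<open>At the right node the integrand already has the slope of the next cell; this
      single point is removed.\<close>
    show "negligible {real (Suc k) * h}" by simp
    show "?f \<tau> = s k \<bullet> c" if "\<tau> \<in> {real k * h..t} - {real (Suc k) * h}" for \<tau>
    proof -
      have "real k \<le> \<tau> / h" "\<tau> / h < real k + 1" using that t h by (auto simp: field_simps)
      then have "\<lfloor>\<tau> / h\<rfloor> = int k" by (intro floor_unique) auto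
      then show ?thesis by simp
    qed
    have "((\<lambda>_. s k \<bullet> c) has_integral (t - real k * h) *\<^sub>R (s k \<bullet> c)) {real k * h..t}"
      using has_integral_const_real[of "s k \<bullet> c" "real k * h" t] t by simp
    then show "((\<lambda>_. s k \<bullet> c) has_integral ((pw_affine h u s t - u k) \<bullet> c)) {real k * h..t}"
      using pw_affine_eq[where s = s, OF h us t] by simp
  qed
  have node: "pw_affine h u s (real k * h) = u k" for k
    using pw_affine_eq[where s = s and t = "real k * h" and k = k, OF h us] h
    by (simp add: distrib_right)
  have main: "(?f has_integral ((pw_affine h u s t - u 0) \<bullet> c)) {0..t}"
    if t: "real k * h \<le> t" "t \<le> real (Suc k) * h" for t k
    using t
  proof (induction k arbitrary: t)
    case 0
    then show ?case using cell[of 0 t] by simp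
  next
    case (Suc k)
    have "(?f has_integral ((u (Suc k) - u 0) \<bullet> c)) {0..real (Suc k) * h}"
      using Suc.IH[of "real (Suc k) * h"] h node[of "Suc k"] by (simp add: algebra_simps)
    from has_integral_combine[OF _ _ this cell[OF Suc.prems]] h Suc.prems
    show ?case by (simp add: inner_diff_left algebra_simps)
  qed
  from main[OF grid_cell[OF \<open>0 \<le> t\<close> h]] node[of 0]
  show "(?f has_integral ((pw_affine h u s t - pw_affine h u s 0) \<bullet> c)) {0..t}" by simp
qed

section \<open>The dissipative inclusion\<close>

text \<open>The subgradient inequality at the point 0 excludes the value +infinity and minimality
  excludes -infinity, so monotonicity can be computed in the reals.\<close>

lemma subdiff_bounds:
  assumes "\<And>y. \<phi> 0 \<le> \<phi> y" "\<phi> 0 = 0" "\<xi> \<in> subdiff \<phi> w"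
  shows "\<bar>\<phi> w\<bar> \<noteq> \<infinity>"
proof -
  have "\<phi> w + ereal (\<xi> \<bullet> (0 - w)) \<le> 0"
    using assms(2,3) unfolding subdiff_def by (auto dest: spec[of _ 0])
  then have "\<phi> w \<noteq> \<infinity>" by auto
  moreover have "\<phi> w \<noteq> -\<infinity>" using assms(1)[of w] assms(2) by auto
  ultimately show ?thesis by auto
qed

locale dry_friction =
  fixes F :: "'a::real_inner \<Rightarrow> 'a" and \<phi> :: "'a \<Rightarrow> ereal" and \<gamma> \<beta> L :: real
  assumes \<gamma>: "\<gamma> \<ge> 0" and \<beta>: "\<beta> \<ge> 0" and L: "L \<ge> 0"
    and F_lip: "norm (F y - F z) \<le> L * norm (y - z)"
    and \<phi>_zero: "\<phi> 0 = 0" and \<phi>_min: "\<phi> 0 \<le> \<phi> y"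
begin

lemma subdiff_monotone:
  assumes "\<xi> \<in> subdiff \<phi> w" "\<eta> \<in> subdiff \<phi> z"
  shows "0 \<le> (\<xi> - \<eta>) \<bullet> (w - z)"
proof -
  obtain a b where ab: "\<phi> w = ereal a" "\<phi> z = ereal b"
    using subdiff_bounds[of \<phi>, OF \<phi>_min \<phi>_zero] assms by (metis abs_neq_infinity_cases)
  have "\<phi> w + ereal (\<xi> \<bullet> (z - w)) \<le> \<phi> z" "\<phi> z + ereal (\<eta> \<bullet> (w - z)) \<le> \<phi> w"
    using assms by (auto simp: subdiff_def)
  then show ?thesis using ab by (simp add: inner_diff_left inner_diff_right algebra_simps)
qed

text \<open>Monotonicity against \<open>\<eta> = - G + d *\<^sub>R sgn w \<in> subdiff \<phi> 0\<close>.\<close>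

lemma subdiff_margin:
  assumes "cball (- G0) (2 * d) \<subseteq> subdiff \<phi> 0" "0 \<le> d" "norm (G - G0) \<le> d" "\<xi> \<in> subdiff \<phi> w"
  shows "d * norm w \<le> (\<xi> + G) \<bullet> w"
proof -
  let ?\<eta> = "- G + d *\<^sub>R sgn w"
  have "norm ((G - G0) - d *\<^sub>R sgn w) \<le> norm (G - G0) + norm (d *\<^sub>R sgn w)"
    by (rule norm_triangle_ineq4)
  also have "\<dots> \<le> d + d"
    using assms(2,3) by (intro add_mono) (auto simp: norm_sgn)
  finally have "?\<eta> \<in> cball (- G0) (2 * d)"
    by (simp add: dist_norm algebra_simps)
  then have "0 \<le> (\<xi> - ?\<eta>) \<bullet> (w - 0)" using assms by (intro subdiff_monotone) auto
  moreover have "sgn w \<bullet> w = norm w"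
    by (cases "w = 0") (simp_all add: sgn_div_norm power2_norm_eq_inner[symmetric] power2_eq_square)
  ultimately show ?thesis by (simp add: inner_diff_left inner_add_left)
qed

subsection \<open>A priori bounds for the scheme\<close>

text \<open>The discrete acceleration, which is also the slope of \<open>interp_v\<close> on the
  cell with index \<open>k\<close>.\<close>

definition step_grad :: "real \<Rightarrow> (nat \<Rightarrow> 'a) \<Rightarrow> nat \<Rightarrow> 'a" where
  "step_grad h V k = (V (Suc k) - V k) /\<^sub>R h"

lemma step_V: "h > 0 \<Longrightarrow> V (Suc k) = V k + h *\<^sub>R step_grad h V k"
  by (simp add: step_grad_def)

lemma scheme_X:
  assumes "discrete_scheme F \<phi> \<gamma> \<beta> x0 v0 h X V" "h > 0"
  shows "X (Suc k) = X k + h *\<^sub>R V (Suc k)"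
proof -
  have "V (Suc k) = (X (Suc k) - X k) /\<^sub>R h" using assms(1) by (simp add: discrete_scheme_def)
  then show ?thesis using assms(2) by simp
qed

lemma scheme_subdiff:
  assumes "discrete_scheme F \<phi> \<gamma> \<beta> x0 v0 h X V"
  shows "- (step_grad h V k + \<gamma> *\<^sub>R V (Suc k) + F (X k + \<beta> *\<^sub>R V k)) \<in> subdiff \<phi> (V (Suc k))"
proof -
  obtain \<xi> where \<xi>: "\<xi> \<in> subdiff \<phi> (V (Suc k))"
    "step_grad h V k + \<gamma> *\<^sub>R V (Suc k) + \<xi> + F (X k + \<beta> *\<^sub>R V k) = 0"
    using assms unfolding discrete_scheme_def step_grad_def by blast
  then have "\<xi> = - (step_grad h V k + \<gamma> *\<^sub>R V (Suc k) + F (X k + \<beta> *\<^sub>R V k))"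
    by (simp add: eq_neg_iff_add_eq_0 algebra_simps)
  then show ?thesis using \<xi>(1) by simp
qed

lemma scheme_force_diff:
  assumes "discrete_scheme F \<phi> \<gamma> \<beta> x0 v0 h X V" "h > 0"
  shows "norm (F (X (Suc k) + \<beta> *\<^sub>R V (Suc k)) - F (X k + \<beta> *\<^sub>R V k))
       \<le> h * L * (norm (V (Suc k)) + \<beta> * norm (step_grad h V k))"
proof -
  have "norm (F (X (Suc k) + \<beta> *\<^sub>R V (Suc k)) - F (X k + \<beta> *\<^sub>R V k))
      \<le> L * norm ((X (Suc k) + \<beta> *\<^sub>R V (Suc k)) - (X k + \<beta> *\<^sub>R V k))" by (rule F_lip)
  also have "(X (Suc k) + \<beta> *\<^sub>R V (Suc k)) - (X k + \<beta> *\<^sub>R V k)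
      = h *\<^sub>R (V (Suc k) + \<beta> *\<^sub>R step_grad h V k)"
    using assms(2) by (simp add: scheme_X[OF assms] step_grad_def algebra_simps)
  also have "L * norm \<dots> \<le> L * (h * (norm (V (Suc k)) + \<beta> * norm (step_grad h V k)))"
    using assms(2) L \<beta> norm_triangle_ineq[of "V (Suc k)" "\<beta> *\<^sub>R step_grad h V k"]
    by (intro mult_left_mono) (auto intro!: mult_left_mono)
  finally show ?thesis by (simp add: mult_ac)
qed

lemma norm_le_of_inner_le:
  fixes a :: 'a
  assumes "a \<bullet> a \<le> b * norm a" "b \<ge> 0"
  shows "norm a \<le> b"
proof (cases "a = 0")
  case False
  then have "norm a * norm a \<le> b * norm a"
    using assms by (simp add: power2_norm_eq_inner[symmetric] power2_eq_square)
  then show ?thesis using False by simp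
qed (use assms in auto)

text \<open>The element \<open>\<xi>0\<close> plays the role of a selection preceding the first
  step: monotonicity between \<open>V 1\<close> and \<open>v0\<close>, divided by \<open>h\<close>,
  bounds the first acceleration independently of \<open>h\<close>.\<close>

lemma step_grad_0_le:
  assumes sch: "discrete_scheme F \<phi> \<gamma> \<beta> x0 v0 h X V" "h > 0" and \<xi>0: "\<xi>0 \<in> subdiff \<phi> v0"
  shows "norm (step_grad h V 0) \<le> \<gamma> * norm v0 + norm \<xi>0 + norm (F (x0 + \<beta> *\<^sub>R v0))"
proof (rule norm_le_of_inner_le)
  let ?A = "step_grad h V 0" and ?G = "F (x0 + \<beta> *\<^sub>R v0)"
  have V0: "V 0 = v0" "X 0 = x0" using sch by (auto simp: discrete_scheme_def)
  have V1: "V (Suc 0) = v0 + h *\<^sub>R ?A" using step_V[OF sch(2), of V 0] V0 by simp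
  have "0 \<le> (- (?A + \<gamma> *\<^sub>R V (Suc 0) + ?G) - \<xi>0) \<bullet> (V (Suc 0) - v0)"
    using subdiff_monotone[OF scheme_subdiff[OF sch(1), of 0] \<xi>0] V0 by simp
  also have "\<dots> = h * ((- (?A + \<gamma> *\<^sub>R V (Suc 0) + ?G) - \<xi>0) \<bullet> ?A)"
    by (simp add: V1)
  finally have "0 \<le> (- (?A + \<gamma> *\<^sub>R V (Suc 0) + ?G) - \<xi>0) \<bullet> ?A"
    using sch(2) by (simp add: zero_le_mult_iff)
  also have "\<dots> = - (?A \<bullet> ?A) - \<gamma> * h * (?A \<bullet> ?A) - (\<gamma> *\<^sub>R v0 + \<xi>0 + ?G) \<bullet> ?A"
    by (simp add: V1 inner_diff_left inner_add_left algebra_simps)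
  finally have "?A \<bullet> ?A \<le> - ((\<gamma> *\<^sub>R v0 + \<xi>0 + ?G) \<bullet> ?A) - \<gamma> * h * (?A \<bullet> ?A)" by simp
  moreover have "0 \<le> \<gamma> * h * (?A \<bullet> ?A)" using \<gamma> sch(2) by simp
  ultimately have "?A \<bullet> ?A \<le> (- (\<gamma> *\<^sub>R v0 + \<xi>0 + ?G)) \<bullet> ?A"
    by (simp only: inner_minus_left)
  also have "\<dots> \<le> norm (\<gamma> *\<^sub>R v0 + \<xi>0 + ?G) * norm ?A"
    using norm_cauchy_schwarz[of "- (\<gamma> *\<^sub>R v0 + \<xi>0 + ?G)" ?A] by (simp only: norm_minus_cancel)
  also have "\<dots> \<le> (\<gamma> * norm v0 + norm \<xi>0 + norm ?G) * norm ?A"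
    using \<gamma> norm_triangle_ineq[of "\<gamma> *\<^sub>R v0 + \<xi>0" ?G] norm_triangle_ineq[of "\<gamma> *\<^sub>R v0" \<xi>0]
    by (intro mult_right_mono) auto
  finally show "?A \<bullet> ?A \<le> (\<gamma> * norm v0 + norm \<xi>0 + norm ?G) * norm ?A" .
qed (use \<gamma> in auto)

text \<open>Two successive inclusions are subtracted and tested with the velocity increment, which
  is \<open>h\<close> times the new acceleration. The damping difference has a favourable sign, so
  only the change of the explicit force remains.\<close>

lemma step_grad_Suc_le:
  assumes sch: "discrete_scheme F \<phi> \<gamma> \<beta> x0 v0 h X V" "h > 0"
  shows "norm (step_grad h V (Suc k))
       \<le> norm (step_grad h V k) + h * L * (norm (V (Suc k)) + \<beta> * norm (step_grad h V k))"
proof (rule norm_le_of_inner_le)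
  let ?A = "step_grad h V k" and ?B = "step_grad h V (Suc k)"
  let ?G = "F (X k + \<beta> *\<^sub>R V k)" and ?H = "F (X (Suc k) + \<beta> *\<^sub>R V (Suc k))"
  let ?D = "?H - ?G"
  have V2: "V (Suc (Suc k)) = V (Suc k) + h *\<^sub>R ?B" using step_V[OF sch(2)] .
  have "0 \<le> (- (?B + \<gamma> *\<^sub>R V (Suc (Suc k)) + ?H) - (- (?A + \<gamma> *\<^sub>R V (Suc k) + ?G)))
          \<bullet> (V (Suc (Suc k)) - V (Suc k))"
    by (rule subdiff_monotone[OF scheme_subdiff[OF sch(1)] scheme_subdiff[OF sch(1)]])
  also have "\<dots> = h * ((?A - ?B - (\<gamma> * h) *\<^sub>R ?B - ?D) \<bullet> ?B)"
    by (simp add: V2 algebra_simps)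
  finally have "0 \<le> (?A - ?B - (\<gamma> * h) *\<^sub>R ?B - ?D) \<bullet> ?B"
    using sch(2) by (simp add: zero_le_mult_iff)
  moreover have "0 \<le> \<gamma> * h * (?B \<bullet> ?B)" using \<gamma> sch(2) by simp
  ultimately have "?B \<bullet> ?B \<le> (?A - ?D) \<bullet> ?B"
    by (simp add: inner_diff_left algebra_simps)
  also have "\<dots> \<le> norm (?A - ?D) * norm ?B" by (rule norm_cauchy_schwarz)
  also have "\<dots> \<le> (norm ?A + h * L * (norm (V (Suc k)) + \<beta> * norm ?A)) * norm ?B"
    using norm_triangle_ineq4[of ?A ?D] scheme_force_diff[OF sch, of k]
    by (intro mult_right_mono) auto
  finally show "?B \<bullet> ?B \<le> (norm ?A + h * L * (norm (V (Suc k)) + \<beta> * norm ?A)) * norm ?B" .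
qed (use sch L \<beta> in auto)

text \<open>The force increment couples acceleration and velocity, so their sum \<open>W\<close> is
  propagated by a discrete Gronwall argument. The bound \<open>M\<close> is the same for all step
  sizes up to 1.\<close>

lemma scheme_bounded:
  assumes \<xi>0: "\<xi>0 \<in> subdiff \<phi> v0" and S: "S \<ge> 0"
  shows "\<exists>M\<ge>0. \<forall>h X V k. 0 < h \<and> h \<le> 1 \<and> discrete_scheme F \<phi> \<gamma> \<beta> x0 v0 h X V \<and> real k * h \<le> S \<longrightarrow>
     norm (V (Suc k)) \<le> M \<and> norm (step_grad h V k) \<le> M \<and> norm (F (X k + \<beta> *\<^sub>R V k)) \<le> M"
proof -
  define a where "a = \<gamma> * norm v0 + norm \<xi>0 + norm (F (x0 + \<beta> *\<^sub>R v0))"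
  \<comment> \<open>One \<open>L * (1 + \<beta>)\<close> comes from the growth of the acceleration,
    the other from inserting that growth into the velocity update with \<open>h \<le> 1\<close>, and
    1 from the old acceleration in that update. Below, \<open>2 * a + norm v0\<close> bounds
    \<open>W 0\<close>.\<close>
  define \<kappa> where "\<kappa> = 2 * L * (1 + \<beta>) + 1"
  define M1 where "M1 = (2 * a + norm v0) * exp (\<kappa> * S)"
  \<comment> \<open>The force starts from its initial value and changes by at most
    \<open>h * (L * (1 + \<beta>) * M1)\<close> per step, over a total time of at most
    \<open>S\<close>.\<close>
  define M where "M = M1 + norm (F (x0 + \<beta> *\<^sub>R v0)) + S * (L * (1 + \<beta>) * M1)"
  have a: "a \<ge> 0" using \<gamma> by (simp add: a_def)
  have \<kappa>: "\<kappa> \<ge> 0" using L \<beta> by (simp add: \<kappa>_def)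
  have M1: "M1 \<ge> 0" using a by (simp add: M1_def)
  have c: "0 \<le> L * (1 + \<beta>) * M1" using L \<beta> M1 by simp
  then have "M1 \<le> M" "M \<ge> 0" using S M1 by (auto simp: M_def)
  moreover
  have "norm (V (Suc k)) \<le> M1 \<and> norm (step_grad h V k) \<le> M1 \<and> norm (F (X k + \<beta> *\<^sub>R V k)) \<le> M"
    if h: "0 < h" "h \<le> 1" and sch: "discrete_scheme F \<phi> \<gamma> \<beta> x0 v0 h X V" and k: "real k * h \<le> S"
    for h X V k
  proof -
    have V0: "V 0 = v0" "X 0 = x0" using sch by (auto simp: discrete_scheme_def)
    define W where "W k = norm (step_grad h V k) + norm (V (Suc k))" for k
    have W0: "W 0 \<le> 2 * a + norm v0"
    proof -
      have 1: "norm (step_grad h V 0) \<le> a"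
        unfolding a_def by (rule step_grad_0_le[OF sch h(1) \<xi>0])
      have "norm (V (Suc 0)) \<le> norm v0 + h * norm (step_grad h V 0)"
        using step_V[OF h(1), of V 0] norm_triangle_ineq[of v0 "h *\<^sub>R step_grad h V 0"] h V0 by simp
      also have "h * norm (step_grad h V 0) \<le> 1 * a" using 1 h a by (intro mult_mono) auto
      finally show ?thesis using 1 by (simp add: W_def)
    qed
    have W_step: "W (Suc k) \<le> (1 + \<kappa> * h) * W k" for k
    proof -
      let ?A = "norm (step_grad h V k)" and ?v = "norm (V (Suc k))"
      let ?B = "norm (step_grad h V (Suc k))" and ?w = "norm (V (Suc (Suc k)))"
      have "?v + \<beta> * ?A \<le> (1 + \<beta>) * W k"
        using \<beta> by (simp add: W_def algebra_simps mult_left_mono)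
      then have "h * L * (?v + \<beta> * ?A) \<le> h * L * ((1 + \<beta>) * W k)"
        using h L by (intro mult_left_mono) auto
      with step_grad_Suc_le[OF sch h(1), of k]
      have B: "?B \<le> ?A + h * (L * (1 + \<beta>) * W k)" by (simp add: mult_ac)
      have "?w \<le> ?v + h * ?B"
        using step_V[OF h(1), of V "Suc k"] norm_triangle_ineq[of "V (Suc k)" "h *\<^sub>R step_grad h V (Suc k)"] h
        by simp
      also have "h * ?B \<le> h * (?A + h * (L * (1 + \<beta>) * W k))"
        using B h by (intro mult_left_mono) auto
      also have "\<dots> \<le> h * (W k + 1 * (L * (1 + \<beta>) * W k))"
        using h L \<beta> by (intro mult_left_mono add_mono mult_right_mono) (auto simp: W_def)
      finally show ?thesis using B by (simp add: W_def \<kappa>_def algebra_simps)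
    qed
    have W_pow: "W k \<le> (1 + \<kappa> * h) ^ k * W 0" for k
    proof (induction k)
      case (Suc k)
      have "W (Suc k) \<le> (1 + \<kappa> * h) * ((1 + \<kappa> * h) ^ k * W 0)"
        using W_step[of k] mult_left_mono[OF Suc, of "1 + \<kappa> * h"] \<kappa> h by simp
      then show ?case by (simp add: mult_ac)
    qed simp
    have W_le: "W j \<le> M1" if j: "real j * h \<le> S" for j
    proof -
      have "(1 + \<kappa> * h) ^ j \<le> exp (\<kappa> * h) ^ j"
        using \<kappa> h by (intro power_mono) auto
      also have "\<dots> = exp (\<kappa> * (real j * h))" by (simp add: exp_of_nat_mult[symmetric] mult_ac)
      also have "\<dots> \<le> exp (\<kappa> * S)" using j \<kappa> by (simp add: mult_left_mono)
      finally have "(1 + \<kappa> * h) ^ j * W 0 \<le> exp (\<kappa> * S) * (2 * a + norm v0)"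
        using W0 by (intro mult_mono) (auto simp: W_def)
      then show ?thesis using W_pow[of j] by (simp add: M1_def mult.commute)
    qed
    have F_le: "real j * h \<le> S \<Longrightarrow>
        norm (F (X j + \<beta> *\<^sub>R V j)) \<le> norm (F (x0 + \<beta> *\<^sub>R v0)) + real j * h * (L * (1 + \<beta>) * M1)" for j
    proof (induction j)
      case 0
      then show ?case by (simp add: V0)
    next
      case (Suc j)
      then have jS: "real j * h \<le> S" using h by (simp add: algebra_simps)
      have A: "norm (step_grad h V j) \<le> M1" and v: "norm (V (Suc j)) \<le> M1"
        using W_le[OF jS] norm_ge_zero[of "step_grad h V j"] norm_ge_zero[of "V (Suc j)"]
        unfolding W_def by linarith+
      have "h * L * (norm (V (Suc j)) + \<beta> * norm (step_grad h V j)) \<le> h * L * (M1 + \<beta> * M1)"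
        using A v h L \<beta> by (intro mult_left_mono add_mono) auto
      then have "norm (F (X (Suc j) + \<beta> *\<^sub>R V (Suc j)) - F (X j + \<beta> *\<^sub>R V j)) \<le> h * (L * (1 + \<beta>) * M1)"
        using scheme_force_diff[OF sch h(1), of j] by (simp add: algebra_simps)
      then show ?case
        using Suc.IH[OF jS]
          norm_triangle_sub[of "F (X (Suc j) + \<beta> *\<^sub>R V (Suc j))" "F (X j + \<beta> *\<^sub>R V j)"]
        by (simp add: algebra_simps)
    qed
    have "real k * h * (L * (1 + \<beta>) * M1) \<le> S * (L * (1 + \<beta>) * M1)"
      using k c by (rule mult_right_mono)
    then have "norm (F (X k + \<beta> *\<^sub>R V k)) \<le> M" using F_le[OF k] M1 by (simp add: M_def)
    moreover have "norm (step_grad h V k) \<le> M1" "norm (V (Suc k)) \<le> M1"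
      using W_le[OF k] norm_ge_zero[of "step_grad h V k"] norm_ge_zero[of "V (Suc k)"]
      unfolding W_def by linarith+
    ultimately show ?thesis by simp
  qed
  ultimately show ?thesis by (intro exI[of _ M]) fastforce
qed

subsection \<open>Finite-time extinction of the scheme\<close>

text \<open>The inclusion at the new velocity \<open>w\<close> is tested with \<open>w\<close>; the
  margin yields the loss \<open>h * d * norm w\<close>, and one factor \<open>norm w\<close>
  cancels. The maximum with 0 covers a step that lands at rest.\<close>

lemma scheme_decay:
  assumes sch: "discrete_scheme F \<phi> \<gamma> \<beta> x0 v0 h X V" "h > 0"
    and margin: "cball (- G0) (2 * d) \<subseteq> subdiff \<phi> 0" "0 \<le> d"
    and near: "norm (F (X k + \<beta> *\<^sub>R V k) - G0) \<le> d"
  shows "norm (V (Suc k)) \<le> max 0 (norm (V k) - h * d)"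
proof (cases "V (Suc k) = 0")
  case False
  let ?w = "V (Suc k)" and ?A = "step_grad h V k" and ?G = "F (X k + \<beta> *\<^sub>R V k)"
  have "d * norm ?w \<le> (- (?A + \<gamma> *\<^sub>R ?w + ?G) + ?G) \<bullet> ?w"
    by (rule subdiff_margin[OF margin near scheme_subdiff[OF sch(1)]])
  then have 0: "d * norm ?w + ?A \<bullet> ?w + \<gamma> * (?w \<bullet> ?w) \<le> 0"
    by (simp add: inner_add_left algebra_simps)
  then have "h * (d * norm ?w + ?A \<bullet> ?w) \<le> 0"
    using sch(2) \<gamma> inner_ge_zero[of ?w] by (smt (verit) mult_nonneg_nonneg mult_nonneg_nonpos)
  moreover have "h * (?A \<bullet> ?w) = ?w \<bullet> ?w - V k \<bullet> ?w"
    using sch(2) by (simp add: step_grad_def inner_diff_left)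
  ultimately have "norm ?w * norm ?w \<le> V k \<bullet> ?w - h * d * norm ?w"
    by (simp add: power2_norm_eq_inner[symmetric] power2_eq_square algebra_simps)
  also have "\<dots> \<le> (norm (V k) - h * d) * norm ?w"
    using norm_cauchy_schwarz[of "V k" ?w] by (simp add: algebra_simps)
  finally show ?thesis using False by simp
qed simp

text \<open>At rest the position does not move, so the force stays within the margin, and the decay
  estimate keeps the next velocity at 0.\<close>

lemma scheme_stopped:
  assumes sch: "discrete_scheme F \<phi> \<gamma> \<beta> x0 v0 h X V" "h > 0"
    and margin: "cball (- G0) (2 * d) \<subseteq> subdiff \<phi> 0" "0 \<le> d"
    and near: "norm (F (X J) - G0) \<le> d" and VJ: "V J = 0"
  shows "V (J + i) = 0 \<and> X (J + i) = X J"
proof (induction i)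
  case (Suc i)
  then have "norm (V (Suc (J + i))) \<le> max 0 (norm (V (J + i)) - h * d)"
    using near by (intro scheme_decay[OF sch margin]) auto
  then have "V (Suc (J + i)) = 0" using Suc sch(2) margin(2) by simp
  then show ?case using Suc scheme_X[OF sch, of "J + i"] by simp
qed (use VJ in simp)

end

section \<open>Strong solutions\<close>

lemma AE_lebesgue_on_negligible:
  assumes "AE t in lebesgue_on S. P t" "S \<in> sets lebesgue"
  obtains N where "negligible N" "\<And>t. t \<in> S - N \<Longrightarrow> P t"
proof -
  have "AE t in lebesgue. t \<in> S \<longrightarrow> P t"
    using assms by (simp add: AE_restrict_space_iff)
  from AE_E3[OF this] obtain N where "N \<in> null_sets lebesgue" "\<And>t. t \<in> space lebesgue - N \<Longrightarrow> t \<in> S \<longrightarrow> P t"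
    by blast
  then show ?thesis using that[of N] by (auto simp: negligible_iff_null_sets)
qed

lemma L2_square_integrable_on:
  fixes g :: "real \<Rightarrow> 'a::real_normed_vector"
  assumes "g \<in> L2 T"
  shows "(\<lambda>t. (norm (g t))\<^sup>2) integrable_on {0..T}"
proof -
  have "(\<lambda>t. (norm (g t))\<^sup>2) integrable_on {0<..<T}"
    using assms by (intro integrable_on_lebesgue_on) (auto simp: L2_def)
  then show ?thesis by (simp add: integrable_on_Icc_iff_Ioo)
qed

context dry_friction
begin

text \<open>The selection is eliminated through the equation. A single integrable \<open>n\<close>
  dominates both the acceleration and the selection, and a single null set \<open>N\<close> collects
  all exceptional times.\<close>

definition weak_solution ::
    "real \<Rightarrow> (real \<Rightarrow> 'a) \<Rightarrow> (real \<Rightarrow> 'a) \<Rightarrow> (real \<Rightarrow> 'a) \<Rightarrow> (real \<Rightarrow> real) \<Rightarrow> real set \<Rightarrow> bool" where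
  "weak_solution T x v v' n N \<longleftrightarrow>
     weak_primitive 0 T x v \<and> weak_primitive 0 T v v' \<and> continuous_on {0..T} v \<and>
     n integrable_on {0..T} \<and> (\<forall>t. 0 \<le> n t) \<and> negligible N \<and>
     (\<forall>t\<in>{0..T} - N. - (v' t + \<gamma> *\<^sub>R v t + F (x t + \<beta> *\<^sub>R v t)) \<in> subdiff \<phi> (v t) \<and>
        norm (v' t) \<le> n t \<and> norm (v' t + \<gamma> *\<^sub>R v t + F (x t + \<beta> *\<^sub>R v t)) \<le> n t)"

lemma strong_solution_weak:
  assumes "strong_solution F \<phi> \<gamma> \<beta> x0 v0 T x v"
  obtains v' n N where "weak_solution T x v v' n N" "x 0 = x0" "v 0 = v0"
proof -
  obtain x' v' \<xi> where W: "has_W12_deriv T x x'" "has_W12_deriv T v v'" and init: "x 0 = x0" "v 0 = v0"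
    and \<xi>: "\<xi> \<in> L2 T"
    and AE: "AE t in lebesgue_on {0<..<T}. v t = x' t" "AE t in lebesgue_on {0<..<T}. \<xi> t \<in> subdiff \<phi> (v t)"
      "AE t in lebesgue_on {0<..<T}. v' t + \<gamma> *\<^sub>R v t + \<xi> t + F (x t + \<beta> *\<^sub>R v t) = 0"
    using assms unfolding strong_solution_def by blast
  from AE have "AE t in lebesgue_on {0<..<T}. v t = x' t \<and> \<xi> t \<in> subdiff \<phi> (v t) \<and>
      v' t + \<gamma> *\<^sub>R v t + \<xi> t + F (x t + \<beta> *\<^sub>R v t) = 0" by eventually_elim auto
  from AE_lebesgue_on_negligible[OF this] obtain N0 where N0: "negligible N0"
    and eq0: "\<And>t. t \<in> {0<..<T} - N0 \<Longrightarrow> v t = x' t \<and> \<xi> t \<in> subdiff \<phi> (v t) \<and>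
      v' t + \<gamma> *\<^sub>R v t + \<xi> t + F (x t + \<beta> *\<^sub>R v t) = 0" by auto
  \<comment> \<open>The end points are added because the almost-everywhere conditions concern the
    open interval only.\<close>
  define N where "N = N0 \<union> {0, T}"
  \<comment> \<open>Since a \<le> 1 + a^2, square integrability on a bounded interval gives an
    integrable majorant of both norms.\<close>
  define n where "n t = (1 + (norm (v' t))\<^sup>2) + (1 + (norm (\<xi> t))\<^sup>2)" for t
  have N: "negligible N" using N0 by (simp add: N_def)
  have eq: "v t = x' t" "\<xi> t \<in> subdiff \<phi> (v t)"
      "\<xi> t = - (v' t + \<gamma> *\<^sub>R v t + F (x t + \<beta> *\<^sub>R v t))" if "t \<in> {0..T} - N" for t
    using eq0[of t] that by (auto simp: N_def eq_neg_iff_add_eq_0 algebra_simps)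
  have n: "n integrable_on {0..T}"
    unfolding n_def using L2_square_integrable_on[OF \<xi>] W
    by (intro integrable_add integrable_const_ivl) (auto simp: has_W12_deriv_def L2_square_integrable_on)
  have norm_le: "norm z \<le> 1 + (norm z)\<^sup>2" for z :: 'a
  proof -
    have "0 \<le> (norm z - 1)\<^sup>2" by simp
    then show ?thesis by (simp add: power2_eq_square algebra_simps) (smt (verit) norm_ge_zero)
  qed
  have n_ge: "norm (v' t) \<le> n t" "norm (\<xi> t) \<le> n t" "0 \<le> n t" for t
    using norm_le[of "v' t"] norm_le[of "\<xi> t"] zero_le_power2[of "norm (v' t)"] zero_le_power2[of "norm (\<xi> t)"]
    unfolding n_def by linarith+
  have x: "weak_primitive 0 T x v"
    by (rule weak_primitive_spike[OF weak_primitive_of_has_integral N eq(1)])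
       (use W(1) in \<open>auto simp: has_W12_deriv_def\<close>)
  have v: "weak_primitive 0 T v v'"
    using W(2) by (intro weak_primitive_of_has_integral) (auto simp: has_W12_deriv_def)
  have cont: "continuous_on {0..T} v"
    by (rule weak_primitive_continuous[OF v n negligible_empty]) (simp add: n_ge)
  have "weak_solution T x v v' n N"
    unfolding weak_solution_def
  proof (intro conjI x v cont n N allI ballI)
    fix t assume t: "t \<in> {0..T} - N"
    show "- (v' t + \<gamma> *\<^sub>R v t + F (x t + \<beta> *\<^sub>R v t)) \<in> subdiff \<phi> (v t)"
      using eq(2,3)[OF t] by simp
    show "norm (v' t + \<gamma> *\<^sub>R v t + F (x t + \<beta> *\<^sub>R v t)) \<le> n t"
      using n_ge(2)[of t] eq(3)[OF t] by (metis norm_minus_cancel)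
  qed (use n_ge in auto)
  then show ?thesis using init by (rule that)
qed

subsection \<open>Finite-time extinction\<close>

text \<open>The same dissipation inequality is used with two convex functions. Half the squared norm
  has a continuous gradient through 0 and shows that rest persists. The norm gives the linear decay
  rate, but its subgradient \<open>sgn\<close> is continuous only away from 0, whence the extra
  premise.\<close>

lemma
  assumes sol: "weak_solution T x v v' n N" and ab: "0 \<le> a" "a \<le> b" "b \<le> T"
    and margin: "cball (- G0) (2 * d) \<subseteq> subdiff \<phi> 0" "0 \<le> d"
    and near: "\<And>t. t \<in> {a..b} \<Longrightarrow> norm (F (x t + \<beta> *\<^sub>R v t) - G0) \<le> d"
  shows weak_solution_stopped: "v a = 0 \<Longrightarrow> v b = 0"
    and weak_solution_decay: "(\<And>t. t \<in> {a..b} \<Longrightarrow> v t \<noteq> 0) \<Longrightarrow> norm (v b) \<le> norm (v a) - d * (b - a)"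
proof -
  have v: "weak_primitive a b v v'"
    using sol ab by (auto simp: weak_solution_def intro: weak_primitive_subinterval)
  have n: "n integrable_on {a..b}"
    using sol ab integrable_subinterval_real[of n 0 T a b] by (auto simp: weak_solution_def)
  have N: "negligible N" and n_le: "\<And>t. t \<in> {a..b} - N \<Longrightarrow> norm (v' t) \<le> n t"
    using sol ab by (auto simp: weak_solution_def)
  have cont: "continuous_on {a..b} v"
    using sol ab by (auto simp: weak_solution_def intro: continuous_on_subset)
  have diss: "v' t \<bullet> v t \<le> - d * norm (v t)" if t: "t \<in> {a..b} - N" for t
  proof -
    let ?G = "F (x t + \<beta> *\<^sub>R v t)"
    have "- (v' t + \<gamma> *\<^sub>R v t + ?G) \<in> subdiff \<phi> (v t)"
      using sol t ab by (auto simp: weak_solution_def)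
    from subdiff_margin[OF margin near this, of t]
    have "d * norm (v t) \<le> (- (v' t + \<gamma> *\<^sub>R v t + ?G) + ?G) \<bullet> v t" using t by auto
    then have "d * norm (v t) \<le> - (v' t \<bullet> v t) - \<gamma> * (v t \<bullet> v t)"
      by (simp add: inner_add_left inner_diff_left)
    moreover have "0 \<le> \<gamma> * (v t \<bullet> v t)" using \<gamma> by simp
    ultimately show ?thesis by linarith
  qed
  {
    assume va: "v a = 0"
    have "(norm (v b))\<^sup>2 / 2 - (norm (v a))\<^sup>2 / 2 \<le> integral {a..b} (\<lambda>_. 0)"
    proof (rule weak_primitive_half_square_le[OF ab(2) v _ n N _ n_le])
      show "v' t \<bullet> v t \<le> 0" if "t \<in> {a..b} - N" for t
        using diss[OF that] mult_nonneg_nonneg[OF margin(2) norm_ge_zero[of "v t"]] by linarith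
    qed auto
    then show "v b = 0" using va by simp
  }
  {
    assume v0: "\<And>t. t \<in> {a..b} \<Longrightarrow> v t \<noteq> 0"
    have sgn_self: "w \<bullet> sgn w = norm w" for w :: 'a
      by (cases "w = 0") (simp_all add: sgn_div_norm power2_norm_eq_inner[symmetric] power2_eq_square)
    have "norm (v b) - norm (v a) \<le> integral {a..b} (\<lambda>_. - d)"
    proof (rule weak_primitive_chain_le[where \<Psi> = "\<lambda>t. norm (v t)", OF ab(2) v _ _ _ n N _ n_le])
      show "continuous_on {a..b} (\<lambda>t. sgn (v t))"
        using cont v0 by (intro continuous_on_sgn) auto
      show "norm (v t) - norm (v s) \<le> (v t - v s) \<bullet> sgn (v t)" for s t
        using norm_cauchy_schwarz[of "v s" "sgn (v t)"] sgn_self[of "v t"]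
        by (auto simp: inner_diff_left norm_sgn split: if_splits)
      show "v' t \<bullet> sgn (v t) \<le> - d" if t: "t \<in> {a..b} - N" for t
        using diss[OF t] v0[of t] t by (simp add: sgn_div_norm field_simps)
    qed auto
    then show "norm (v b) \<le> norm (v a) - d * (b - a)"
      using ab by (simp add: algebra_simps)
  }
qed

section \<open>Comparison of the scheme with the solution\<close>

lemma two_mult_le_squares:
  fixes p q :: real
  shows "p * q \<le> p\<^sup>2 / 2 + q\<^sup>2 / 2"
  using zero_le_power2[of "p - q"] by (simp add: power2_eq_square algebra_simps)

lemma scheme_error:
  assumes sol: "weak_solution S x v v' n N" "x 0 = x0" "v 0 = v0" and S: "S \<ge> 0"
    and \<xi>0: "\<xi>0 \<in> subdiff \<phi> v0"
  shows "\<exists>C>0. \<forall>h X V. 0 < h \<and> h \<le> 1 \<and> discrete_scheme F \<phi> \<gamma> \<beta> x0 v0 h X V \<longrightarrow>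
     (\<forall>t\<in>{0..S}. norm (interp_x h X V t - x t) \<le> C * sqrt h \<and> norm (interp_v h V t - v t) \<le> C * sqrt h)"
proof -
  obtain M where M: "M \<ge> 0" and bound: "\<And>h X V k. 0 < h \<Longrightarrow> h \<le> 1 \<Longrightarrow>
      discrete_scheme F \<phi> \<gamma> \<beta> x0 v0 h X V \<Longrightarrow> real k * h \<le> S \<Longrightarrow>
      norm (V (Suc k)) \<le> M \<and> norm (step_grad h V k) \<le> M \<and> norm (F (X k + \<beta> *\<^sub>R V k)) \<le> M"
    using scheme_bounded[OF \<xi>0 S] by blast
  note sol' = sol(1)[unfolded weak_solution_def]
  have x: "weak_primitive 0 S x v" and v: "weak_primitive 0 S v v'" and cont: "continuous_on {0..S} v"
    and n: "n integrable_on {0..S}" and n0: "0 \<le> n t" and N: "negligible N"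
    for t using sol' by auto
  have incl: "- (v' t + \<gamma> *\<^sub>R v t + F (x t + \<beta> *\<^sub>R v t)) \<in> subdiff \<phi> (v t)"
    and n_v': "norm (v' t) \<le> n t" and n_\<xi>: "norm (v' t + \<gamma> *\<^sub>R v t + F (x t + \<beta> *\<^sub>R v t)) \<le> n t"
    if "t \<in> {0..S} - N" for t using sol' that by blast+
  \<comment> \<open>Coefficients of the energy \<open>U\<close>: \<gamma> from damping at the node
    instead of the interpolant, \<open>L\<close> from the position error in the force,
    \<open>2 * L * \<beta>\<close> from the velocity error, and \<open>L * (1 + \<beta>)\<close>
    from the lag of the explicit force.\<close>
  define K1 where "K1 = \<gamma> + L + 2 * L * \<beta> + L * (1 + \<beta>)"
  \<comment> \<open>Coefficient of \<open>h\<close>: the selections, bounded by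
    \<open>(2 + \<gamma>) * M\<close> and \<open>n t\<close>, are paired with a vector of norm at
    most \<open>h * M\<close>; the rest are remainders of Young's inequality.\<close>
  define q where "q t = M * ((2 + \<gamma>) * M + n t) + (\<gamma> + L * (1 + \<beta>)) * M\<^sup>2 / 2" for t
  define Q where "Q = integral {0..S} (\<lambda>t. q t + M\<^sup>2 / 2)"
  \<comment> \<open>Gronwall bounds \<open>2 * U t\<close> by \<open>h\<close> times the radicand,
    the 2 in \<open>K1 + 2\<close> being due to the position equation. The final 1 makes
    \<open>C\<close> positive.\<close>
  define C where "C = sqrt (4 * Q * exp (2 * (K1 + 2) * S)) + 1"
  have K1: "K1 \<ge> 0" using \<gamma> L \<beta> by (simp add: K1_def)
  have q0: "0 \<le> q t" for t using \<gamma> L \<beta> M n0[of t] by (simp add: q_def)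
  have q: "q integrable_on {0..S}"
    unfolding q_def using n by (intro integrable_add integrable_const_ivl integrable_on_mult_right)
  have Q0: "0 \<le> Q" unfolding Q_def using q0 q
    by (intro integral_nonneg integrable_add integrable_const_ivl) auto
  have C: "C > 0" using Q0 by (simp add: C_def add_nonneg_pos)
  have "norm (interp_x h X V t - x t) \<le> C * sqrt h \<and> norm (interp_v h V t - v t) \<le> C * sqrt h"
    if h: "0 < h" "h \<le> 1" and sch: "discrete_scheme F \<phi> \<gamma> \<beta> x0 v0 h X V" and t: "t \<in> {0..S}" for h X V t
  proof -
    define A where "A = step_grad h V"
    define k where "k \<tau> = nat \<lfloor>\<tau> / h\<rfloor>" for \<tau> :: real
    define e where "e \<tau> = interp_v h V \<tau> - v \<tau>" for \<tau>
    define d where "d \<tau> = interp_x h X V \<tau> - x \<tau>" for \<tau>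
    define U where "U \<tau> = (norm (e \<tau>))\<^sup>2 / 2 + (norm (d \<tau>))\<^sup>2 / 2" for \<tau>
    have V0: "V 0 = v0" "X 0 = x0" using sch by (auto simp: discrete_scheme_def)
    have k: "real (k \<tau>) * h \<le> \<tau>" "\<tau> \<le> real (Suc (k \<tau>)) * h" if "0 \<le> \<tau>" for \<tau>
      using grid_cell[OF that h(1)] by (simp_all add: k_def)
    have bd: "norm (V (Suc (k \<tau>))) \<le> M" "norm (A (k \<tau>)) \<le> M" "norm (F (X (k \<tau>) + \<beta> *\<^sub>R V (k \<tau>))) \<le> M"
      if "\<tau> \<in> {0..S}" for \<tau>
      using bound[OF h sch, of "k \<tau>"] k(1)[of \<tau>] that by (auto simp: A_def)
    have e: "weak_primitive 0 S e (\<lambda>\<tau>. A (k \<tau>) - v' \<tau>)"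
      unfolding e_def interp_v_def A_def step_grad_def k_def
      using h(1) by (intro weak_primitive_diff[OF _ v] weak_primitive_pw_affine) auto
    have d: "weak_primitive 0 S d (\<lambda>\<tau>. V (Suc (k \<tau>)) - v \<tau>)"
      unfolding d_def interp_x_def k_def
      using h(1) scheme_X[OF sch h(1)] by (intro weak_primitive_diff[OF _ x] weak_primitive_pw_affine) auto
    have e0: "e 0 = 0" and d0: "d 0 = 0"
      using sol V0 by (simp_all add: e_def d_def interp_v_def interp_x_def pw_affine_def)
    have ge: "norm (A (k \<tau>) - v' \<tau>) \<le> M + n \<tau>" if "\<tau> \<in> {0..S} - N" for \<tau>
      using norm_triangle_ineq4[of "A (k \<tau>)" "v' \<tau>"] bd(2)[of \<tau>] n_v'[of \<tau>] that by auto
    have gd: "norm (V (Suc (k \<tau>)) - v \<tau>) \<le> M + norm (v \<tau>)" if "\<tau> \<in> {0..S} - {}" for \<tau>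
      using norm_triangle_ineq4[of "V (Suc (k \<tau>))" "v \<tau>"] bd(1)[of \<tau>] that by auto
    have Mn: "(\<lambda>\<tau>. M + n \<tau>) integrable_on {0..S}"
      using n by (intro integrable_add integrable_const_ivl)
    have Mv: "(\<lambda>\<tau>. M + norm (v \<tau>)) integrable_on {0..S}"
      using cont by (intro integrable_continuous_real continuous_intros)
    have e_cont: "continuous_on {0..S} e" by (rule weak_primitive_continuous[OF e Mn N ge])
    have d_cont: "continuous_on {0..S} d" by (rule weak_primitive_continuous[OF d Mv _ gd]) auto
    have U_cont: "continuous_on {0..S} U"
      unfolding U_def using e_cont d_cont by (intro continuous_intros) auto
    \<comment> \<open>Here \<open>h \<le> 1\<close> weakens (h M)^2 to h M^2, so the remainder in
      Young's inequality is linear in \<open>h\<close>.\<close>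
    have hM: "h * M * norm z \<le> h * M\<^sup>2 / 2 + (norm z)\<^sup>2 / 2" for z :: 'a
    proof -
      have "h * h * M\<^sup>2 \<le> h * 1 * M\<^sup>2" using h by (intro mult_right_mono mult_left_mono) auto
      then have "(h * M)\<^sup>2 \<le> h * M\<^sup>2" by (simp add: power2_eq_square mult_ac)
      then show ?thesis using two_mult_le_squares[of "h * M" "norm z"] by linarith
    qed
    have eU: "(norm (e \<tau>))\<^sup>2 / 2 \<le> U \<tau>" and dU: "(norm (d \<tau>))\<^sup>2 / 2 \<le> U \<tau>"
      and edU: "norm (e \<tau>) * norm (d \<tau>) \<le> U \<tau>" for \<tau>
      using two_mult_le_squares[of "norm (e \<tau>)" "norm (d \<tau>)"] by (auto simp: U_def)
    have w_le: "norm (V (Suc (k \<tau>)) - interp_v h V \<tau>) \<le> h * M"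
      and vk_le: "norm (interp_v h V \<tau> - V (k \<tau>)) \<le> h * M"
      and xk_le: "norm (interp_x h X V \<tau> - X (k \<tau>)) \<le> h * M" if \<tau>: "\<tau> \<in> {0..S}" for \<tau>
    proof -
      define \<sigma> where "\<sigma> = \<tau> - real (k \<tau>) * h"
      have \<tau>0: "0 \<le> \<tau>" using \<tau> by simp
      have \<sigma>: "0 \<le> \<sigma>" "\<sigma> \<le> h" using k[of \<tau>] \<tau> by (auto simp: \<sigma>_def algebra_simps)
      have iv: "interp_v h V \<tau> = V (k \<tau>) + \<sigma> *\<^sub>R A (k \<tau>)"
        unfolding \<sigma>_def A_def step_grad_def by (rule interp_v_eq[OF h(1) k[OF \<tau>0]])
      have ix: "interp_x h X V \<tau> = X (k \<tau>) + \<sigma> *\<^sub>R V (Suc (k \<tau>))"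
        unfolding \<sigma>_def by (rule interp_x_eq[OF sch h(1) k[OF \<tau>0]])
      have "V (Suc (k \<tau>)) - interp_v h V \<tau> = (h - \<sigma>) *\<^sub>R A (k \<tau>)"
        using step_V[OF h(1), of V "k \<tau>"] iv by (simp add: A_def algebra_simps)
      then show "norm (V (Suc (k \<tau>)) - interp_v h V \<tau>) \<le> h * M"
        using \<sigma> h bd[OF \<tau>] M by (auto intro!: mult_mono)
      show "norm (interp_v h V \<tau> - V (k \<tau>)) \<le> h * M" "norm (interp_x h X V \<tau> - X (k \<tau>)) \<le> h * M"
        using \<sigma> h bd[OF \<tau>] M iv ix by (auto intro!: mult_mono)
    qed
    have me: "(A (k \<tau>) - v' \<tau>) \<bullet> e \<tau> \<le> K1 * U \<tau> + h * q \<tau>" if \<tau>: "\<tau> \<in> {0..S} - N" for \<tau>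
    proof -
      have \<tau>': "\<tau> \<in> {0..S}" using \<tau> by auto
      let ?e = "e \<tau>" and ?E = "norm (e \<tau>)" and ?D = "norm (d \<tau>)"
      define v1 where "v1 = V (Suc (k \<tau>))"
      define G where "G = F (x \<tau> + \<beta> *\<^sub>R v \<tau>)"
      define G1 where "G1 = F (X (k \<tau>) + \<beta> *\<^sub>R V (k \<tau>))"
      define \<zeta> where "\<zeta> = - (v' \<tau> + \<gamma> *\<^sub>R v \<tau> + G)"
      define \<zeta>1 where "\<zeta>1 = - (A (k \<tau>) + \<gamma> *\<^sub>R v1 + G1)"
      define w where "w = v1 - interp_v h V \<tau>"
      have w: "norm w \<le> h * M" using w_le[OF \<tau>'] by (simp add: w_def v1_def)
      have v1_eq: "v1 - v \<tau> = ?e + w" by (simp add: w_def e_def)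
      \<comment> \<open>The inclusions hold at \<open>v \<tau>\<close> and at the node value
        \<open>v1\<close>, not at the interpolant. Their difference is \<open>e \<tau> + w\<close>,
        so the pairing with \<open>w\<close> is left over as an error.\<close>
      have mon: "0 \<le> (\<zeta>1 - \<zeta>) \<bullet> (?e + w)"
        unfolding v1_eq[symmetric] using scheme_subdiff[OF sch, of "k \<tau>"] incl[OF \<tau>]
        by (intro subdiff_monotone) (auto simp: \<zeta>1_def \<zeta>_def v1_def A_def G_def G1_def)
      have "norm \<zeta>1 \<le> norm (A (k \<tau>)) + norm (\<gamma> *\<^sub>R v1) + norm G1"
        unfolding \<zeta>1_def norm_minus_cancel by (intro norm_triangle_le add_right_mono norm_triangle_ineq)
      also have "\<dots> \<le> M + \<gamma> * M + M"
        using bd[OF \<tau>'] \<gamma> by (intro add_mono) (auto simp: v1_def G1_def intro: mult_left_mono)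
      finally have \<zeta>1_le: "norm \<zeta>1 \<le> (2 + \<gamma>) * M" by (simp add: algebra_simps)
      have "norm (\<zeta>1 - \<zeta>) \<le> (2 + \<gamma>) * M + n \<tau>"
        using norm_triangle_ineq4[of \<zeta>1 \<zeta>] \<zeta>1_le n_\<xi>[OF \<tau>]
        unfolding \<zeta>_def G_def norm_minus_cancel by linarith
      then have "(\<zeta>1 - \<zeta>) \<bullet> w \<le> ((2 + \<gamma>) * M + n \<tau>) * (h * M)"
        using w by (intro order_trans[OF norm_cauchy_schwarz] mult_mono) (auto intro: order_trans[OF norm_ge_zero])
      with mon have 1: "- ((\<zeta>1 - \<zeta>) \<bullet> ?e) \<le> h * (M * ((2 + \<gamma>) * M + n \<tau>))"
        by (simp add: inner_add_right algebra_simps)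
      have "- (w \<bullet> ?e) \<le> h * M * ?E"
        using norm_cauchy_schwarz[of "- w" ?e] mult_right_mono[OF w, of ?E] by simp
      then have "- (w \<bullet> ?e) \<le> h * M\<^sup>2 / 2 + U \<tau>" using hM[of ?e] eU[of \<tau>] by linarith
      then have 2: "\<gamma> * (- (w \<bullet> ?e)) \<le> \<gamma> * (h * M\<^sup>2 / 2 + U \<tau>)" using \<gamma> by (rule mult_left_mono)
      have "X (k \<tau>) + \<beta> *\<^sub>R V (k \<tau>) - (x \<tau> + \<beta> *\<^sub>R v \<tau>)
          = (d \<tau> - (interp_x h X V \<tau> - X (k \<tau>))) + \<beta> *\<^sub>R (?e - (interp_v h V \<tau> - V (k \<tau>)))"
        by (simp add: d_def e_def algebra_simps)
      also have "norm \<dots> \<le> (?D + h * M) + \<beta> * (?E + h * M)"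
      proof (intro norm_triangle_le add_mono)
        show "norm (d \<tau> - (interp_x h X V \<tau> - X (k \<tau>))) \<le> ?D + h * M"
          using norm_triangle_ineq4[of "d \<tau>" "interp_x h X V \<tau> - X (k \<tau>)"] xk_le[OF \<tau>'] by linarith
        have "norm (?e - (interp_v h V \<tau> - V (k \<tau>))) \<le> ?E + h * M"
          using norm_triangle_ineq4[of ?e "interp_v h V \<tau> - V (k \<tau>)"] vk_le[OF \<tau>'] by linarith
        then show "norm (\<beta> *\<^sub>R (?e - (interp_v h V \<tau> - V (k \<tau>)))) \<le> \<beta> * (?E + h * M)"
          using \<beta> by (auto intro: mult_left_mono)
      qed
      finally have "L * norm (X (k \<tau>) + \<beta> *\<^sub>R V (k \<tau>) - (x \<tau> + \<beta> *\<^sub>R v \<tau>))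
          \<le> L * ((?D + h * M) + \<beta> * (?E + h * M))" using L by (rule mult_left_mono)
      then have G_le: "norm (G1 - G) \<le> L * ((?D + h * M) + \<beta> * (?E + h * M))"
        unfolding G1_def G_def using F_lip order_trans by blast
      have "- ((G1 - G) \<bullet> ?e) \<le> norm (G1 - G) * ?E"
        using norm_cauchy_schwarz[of "- (G1 - G)" ?e] by (simp only: inner_minus_left norm_minus_cancel)
      also have "\<dots> \<le> L * ((?D + h * M) + \<beta> * (?E + h * M)) * ?E" using G_le by (rule mult_right_mono) simp
      also have "\<dots> = L * (?E * ?D) + L * (1 + \<beta>) * (h * M * ?E) + 2 * L * \<beta> * (?E\<^sup>2 / 2)"
        by (simp add: power2_eq_square algebra_simps)
      also have "\<dots> \<le> L * U \<tau> + L * (1 + \<beta>) * (h * M\<^sup>2 / 2 + U \<tau>) + 2 * L * \<beta> * U \<tau>"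
        using L \<beta> edU[of \<tau>] eU[of \<tau>] order_trans[OF hM[of ?e] add_left_mono[OF eU[of \<tau>]]]
        by (intro add_mono mult_left_mono) auto
      finally have 3: "- ((G1 - G) \<bullet> ?e) \<le> \<dots>" .
      have split: "A (k \<tau>) - v' \<tau> = - (\<zeta>1 - \<zeta>) - \<gamma> *\<^sub>R (?e + w) - (G1 - G)"
        unfolding v1_eq[symmetric] by (simp add: \<zeta>1_def \<zeta>_def algebra_simps)
      have "(A (k \<tau>) - v' \<tau>) \<bullet> ?e
          = - ((\<zeta>1 - \<zeta>) \<bullet> ?e) - \<gamma> * (?e \<bullet> ?e) + \<gamma> * (- (w \<bullet> ?e)) - ((G1 - G) \<bullet> ?e)"
        unfolding split by (simp add: inner_diff_left inner_add_left algebra_simps)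
      moreover have "0 \<le> \<gamma> * (?e \<bullet> ?e)" using \<gamma> by simp
      ultimately have "(A (k \<tau>) - v' \<tau>) \<bullet> ?e \<le> h * (M * ((2 + \<gamma>) * M + n \<tau>)) + \<gamma> * (h * M\<^sup>2 / 2 + U \<tau>)
          + (L * U \<tau> + L * (1 + \<beta>) * (h * M\<^sup>2 / 2 + U \<tau>) + 2 * L * \<beta> * U \<tau>)"
        using 1 2 3 by linarith
      also have "\<dots> = K1 * U \<tau> + h * q \<tau>"
        by (simp add: K1_def q_def field_simps)
      finally show ?thesis .
    qed
    have md: "(V (Suc (k \<tau>)) - v \<tau>) \<bullet> d \<tau> \<le> 2 * U \<tau> + h * (M\<^sup>2 / 2)" if \<tau>: "\<tau> \<in> {0..S} - {}" for \<tau>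
    proof -
      have \<tau>': "\<tau> \<in> {0..S}" using \<tau> by auto
      define w where "w = V (Suc (k \<tau>)) - interp_v h V \<tau>"
      have w: "norm w \<le> h * M" using w_le[OF \<tau>'] by (simp add: w_def)
      have "(V (Suc (k \<tau>)) - v \<tau>) \<bullet> d \<tau> = e \<tau> \<bullet> d \<tau> + w \<bullet> d \<tau>"
        by (simp add: w_def e_def inner_diff_left)
      also have "\<dots> \<le> norm (e \<tau>) * norm (d \<tau>) + h * M * norm (d \<tau>)"
        using w by (intro add_mono order_trans[OF norm_cauchy_schwarz] mult_right_mono) auto
      finally show ?thesis using edU[of \<tau>] hM[of "d \<tau>"] dU[of \<tau>] by linarith
    qed
    have U_le: "U s \<le> h * Q + (K1 + 2) * integral {0..s} U" if s: "s \<in> {0..S}" for s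
    proof -
      have s': "0 \<le> s" "0 \<le> (0::real)" "s \<le> S" "{0..s} \<subseteq> {0..S}" using s by auto
      have sub: "f integrable_on {0..s}" if "f integrable_on {0..S}" for f :: "real \<Rightarrow> real"
        by (rule integrable_subinterval_real[OF that s'(4)])
      have U: "U integrable_on {0..s}" by (intro sub integrable_continuous_real U_cont)
      note qs = sub[OF q]
      have "(norm (e s))\<^sup>2 / 2 - (norm (e 0))\<^sup>2 / 2 \<le> integral {0..s} (\<lambda>\<tau>. K1 * U \<tau> + h * q \<tau>)"
      proof (rule weak_primitive_half_square_le[OF s'(1) weak_primitive_subinterval[OF e s'(2,3)] _ sub[OF Mn] N])
        show "(\<lambda>\<tau>. K1 * U \<tau> + h * q \<tau>) integrable_on {0..s}"
          using U qs by (intro integrable_add integrable_on_mult_right)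
      qed (use me ge s in auto)
      moreover have "(norm (d s))\<^sup>2 / 2 - (norm (d 0))\<^sup>2 / 2 \<le> integral {0..s} (\<lambda>\<tau>. 2 * U \<tau> + h * (M\<^sup>2 / 2))"
      proof (rule weak_primitive_half_square_le[OF s'(1) weak_primitive_subinterval[OF d s'(2,3)] _ sub[OF Mv] negligible_empty])
        show "(\<lambda>\<tau>. 2 * U \<tau> + h * (M\<^sup>2 / 2)) integrable_on {0..s}"
          using U by (intro integrable_add integrable_on_mult_right integrable_const_ivl)
      qed (use md gd s in auto)
      moreover have "integral {0..s} (\<lambda>\<tau>. K1 * U \<tau> + h * q \<tau>) + integral {0..s} (\<lambda>\<tau>. 2 * U \<tau> + h * (M\<^sup>2 / 2))
          = integral {0..s} (\<lambda>\<tau>. (K1 + 2) * U \<tau> + h * (q \<tau> + M\<^sup>2 / 2))"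
        using U qs by (subst Henstock_Kurzweil_Integration.integral_add[symmetric])
          (auto simp: algebra_simps intro!: integrable_add integrable_on_mult_right)
      moreover have "\<dots> = (K1 + 2) * integral {0..s} U + h * integral {0..s} (\<lambda>\<tau>. q \<tau> + M\<^sup>2 / 2)"
        using U qs by (subst Henstock_Kurzweil_Integration.integral_add)
          (auto intro!: integrable_add integrable_on_mult_right)
      moreover have "integral {0..s} (\<lambda>\<tau>. q \<tau> + M\<^sup>2 / 2) \<le> Q"
        unfolding Q_def using qs q q0 s' by (intro integral_subset_le integrable_add integrable_const_ivl) auto
      then have "h * integral {0..s} (\<lambda>\<tau>. q \<tau> + M\<^sup>2 / 2) \<le> h * Q" using h by (intro mult_left_mono) auto
      ultimately show ?thesis using e0 d0 by (simp add: U_def)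
    qed
    have "U t \<le> 2 * (h * Q) * exp (2 * (K1 + 2) * t)"
      using K1 h Q0 by (intro gronwall_integral[OF U_cont _ _ U_le t]) auto
    also have "\<dots> \<le> 2 * (h * Q) * exp (2 * (K1 + 2) * S)"
      using K1 h Q0 t by (intro mult_left_mono) (auto intro: mult_left_mono)
    finally have Ut: "2 * U t \<le> 4 * Q * exp (2 * (K1 + 2) * S) * h" by (simp add: mult_ac)
    have fin: "z \<le> C * sqrt h" if "z\<^sup>2 / 2 \<le> U t" for z
    proof -
      have "z \<le> sqrt (4 * Q * exp (2 * (K1 + 2) * S) * h)" using that Ut by (intro real_le_rsqrt) linarith
      also have "\<dots> \<le> C * sqrt h"
        unfolding real_sqrt_mult C_def by (intro mult_right_mono) (use h in auto)
      finally show ?thesis .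
    qed
    show ?thesis using fin[OF dU] fin[OF eU] by (simp add: e_def d_def)
  qed
  then show ?thesis using C by blast
qed

end

section \<open>Stopping times\<close>

text \<open>The invariant counts quanta \<open>h * d\<close> of speed: at most \<open>n - i\<close>
  of them are left after \<open>i\<close> steps.\<close>

lemma (in dry_friction) scheme_extinction:
  assumes sch: "discrete_scheme F \<phi> \<gamma> \<beta> x0 v0 h X V" "h > 0"
    and margin: "cball (- G0) (2 * d) \<subseteq> subdiff \<phi> 0" "0 \<le> d"
    and near: "\<And>k. m \<le> k \<Longrightarrow> k < m + n \<Longrightarrow> norm (F (X k + \<beta> *\<^sub>R V k) - G0) \<le> d"
    and Vm: "norm (V m) \<le> real n * (h * d)"
  shows "V (m + n) = 0"
proof -
  have "i \<le> n \<Longrightarrow> norm (V (m + i)) \<le> real (n - i) * (h * d)" for i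
  proof (induction i)
    case (Suc i)
    have "norm (V (Suc (m + i))) \<le> max 0 (norm (V (m + i)) - h * d)"
      using Suc.prems by (intro scheme_decay[OF sch margin] near) auto
    also have "\<dots> \<le> real (n - Suc i) * (h * d)"
    proof (rule max.boundedI)
      show "0 \<le> real (n - Suc i) * (h * d)" using sch(2) margin(2) by simp
      have eq: "real (n - i) = real (n - Suc i) + 1" using Suc.prems by (simp add: of_nat_diff)
      have "norm (V (m + i)) \<le> real (n - i) * (h * d)" using Suc by simp
      then show "norm (V (m + i)) - h * d \<le> real (n - Suc i) * (h * d)"
        unfolding eq distrib_right by linarith
    qed
    finally show ?case by simp
  qed (use Vm in simp)
  from this[of n] show ?thesis by simp
qed

lemma stop_index_eq:
  assumes "\<forall>k\<ge>J. V k = 0"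
  obtains K where "stop_index V = enat K" "\<forall>k\<ge>K. V k = 0" "K \<le> J"
proof -
  define K where "K = (LEAST K. \<forall>k\<ge>K. V k = 0)"
  have K: "\<forall>k\<ge>K. V k = 0" unfolding K_def by (rule LeastI[of "\<lambda>K. \<forall>k\<ge>K. V k = 0", OF assms])
  have le: "K \<le> i" if "\<forall>k\<ge>i. V k = 0" for i
    unfolding K_def by (rule Least_le[of "\<lambda>K. \<forall>k\<ge>K. V k = 0", OF that])
  have "stop_index V = enat K"
    unfolding stop_index_def using K le by (intro antisym Inf_lower Inf_greatest) auto
  then show ?thesis using K le[OF assms] by (rule that)
qed

lemma tendsto_sqrt_rate:
  fixes g :: "real \<Rightarrow> 'a::real_normed_vector"
  assumes "h0 > 0" "\<And>h. 0 < h \<Longrightarrow> h \<le> h0 \<Longrightarrow> norm (g h - l) \<le> C * sqrt h"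
  shows "(g \<longlongrightarrow> l) (at_right 0)"
proof -
  have "((\<lambda>h. C * sqrt h) \<longlongrightarrow> C * sqrt 0) (at_right 0)"
    by (intro tendsto_intros)
  moreover have "\<forall>\<^sub>F h in at_right 0. norm (g h - l) \<le> C * sqrt h"
    using assms by (intro eventually_at_rightI[of 0 h0]) auto
  ultimately have "((\<lambda>h. g h - l) \<longlongrightarrow> 0) (at_right 0)"
    by (intro Lim_null_comparison[of "\<lambda>h. g h - l" "\<lambda>h. C * sqrt h"]) auto
  then show ?thesis by (simp add: LIM_zero_iff)
qed

lemma
  assumes "stop_time v = ereal T"
  shows stop_time_zero: "t > T \<Longrightarrow> v t = 0"
    and stop_time_minimal: "0 \<le> s \<Longrightarrow> s < T \<Longrightarrow> \<exists>t\<ge>s. v t \<noteq> 0"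
proof -
  let ?A = "{T. 0 \<le> T \<and> (\<forall>t\<ge>T. v t = 0)}"
  have I: "Inf (ereal ` ?A) = ereal T" using assms by (simp add: stop_time_def)
  show "v t = 0" if "t > T"
  proof -
    have "Inf (ereal ` ?A) < ereal t" using I that by simp
    then obtain T' where "T' \<in> ?A" "T' < t" by (auto simp: Inf_less_iff)
    then show ?thesis by auto
  qed
  show "\<exists>t\<ge>s. v t \<noteq> 0" if "0 \<le> s" "s < T"
  proof (rule ccontr)
    assume "\<not> ?thesis"
    then have "Inf (ereal ` ?A) \<le> ereal s" using that(1) by (intro Inf_lower) auto
    then show False using I that(2) by simp
  qed
qed

theorem theorem5p2:
  fixes f :: "'a::{real_inner, complete_space} \<Rightarrow> real"
    and gradf :: "'a \<Rightarrow> 'a"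
    and \<phi> :: "'a \<Rightarrow> ereal"
    and \<gamma> \<beta> L r \<delta> Tstop :: real
    and x0 v0 :: 'a
    and x v :: "real \<Rightarrow> 'a"
    and X V :: "real \<Rightarrow> nat \<Rightarrow> 'a"
  assumes "\<gamma> > 0" and "\<beta> \<ge> 0"
    and f_grad: "\<And>y. GDERIV f y :> gradf y"
    and f_C1: "continuous_on UNIV gradf"
    and f_bdd: "bdd_below (range f)"
    and f_lip: "L \<ge> 0" "L-lipschitz_on UNIV gradf"
    and phi: "proper_fun \<phi>" "lsc_fun \<phi>" "convex_fun \<phi>"
    and phi_min: "\<phi> 0 = 0" "\<And>y. \<phi> 0 \<le> \<phi> y"
    and dry: "r > 0" "cball 0 r \<subseteq> subdiff \<phi> 0"
    and v0: "v0 \<in> Dom_subdiff \<phi>"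
    and sol: "global_strong_solution gradf \<phi> \<gamma> \<beta> x0 v0 x v"
    and scheme: "\<And>h. h > 0 \<Longrightarrow> discrete_scheme gradf \<phi> \<gamma> \<beta> x0 v0 h (X h) (V h)"
    and stop: "stop_time v = ereal Tstop" "Tstop > 0"
    and margin: "\<delta> > 0" "cball (- gradf (x Tstop)) \<delta> \<subseteq> subdiff \<phi> 0"
  shows "(\<forall>\<^sub>F h in at_right 0. stop_index (V h) < \<infinity>) \<and>
    (\<exists>C>0. \<exists>h0>0. \<forall>h. 0 < h \<and> h \<le> h0 \<longrightarrow>
       stop_index (V h) < \<infinity> \<and>
       \<bar>h * real (the_enat (stop_index (V h))) - Tstop\<bar>
         + norm (X h (the_enat (stop_index (V h))) - x Tstop) \<le> C * sqrt h \<and>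
       (SUP t\<in>{0..}. ereal (norm (interp_x h (X h) (V h) t - x t)
                             + norm (interp_v h (V h) t - v t))) \<le> ereal (C * sqrt h)) \<and>
    ((\<lambda>h. h * real (the_enat (stop_index (V h)))) \<longlongrightarrow> Tstop) (at_right 0) \<and>
    ((\<lambda>h. X h (the_enat (stop_index (V h)))) \<longlongrightarrow> x Tstop) (at_right 0)"
proof -
  interpret dry_friction gradf \<phi> \<gamma> \<beta> L
    using assms(1,2) f_lip phi_min
    by unfold_locales (auto simp: lipschitz_on_def dist_norm)
  define S where "S = Tstop + 1"
  define G0 where "G0 = gradf (x Tstop)"
  \<comment> \<open>One \<open>d\<close> is the admissible deviation of the force, the other the
    decay rate.\<close>
  define d where "d = \<delta> / 2"
  have S: "S > 0" "Tstop \<le> S" using stop(2) by (auto simp: S_def)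
  have d: "d > 0" and margin': "cball (- G0) (2 * d) \<subseteq> subdiff \<phi> 0" "0 \<le> d"
    using margin by (auto simp: d_def G0_def)
  obtain \<xi>0 where \<xi>0: "\<xi>0 \<in> subdiff \<phi> v0" using v0 by (auto simp: Dom_subdiff_def)
  have strong: "strong_solution gradf \<phi> \<gamma> \<beta> x0 v0 T x v" if "T > 0" for T
    using sol that by (simp add: global_strong_solution_def)
  obtain v' n N where ws: "weak_solution S x v v' n N" "x 0 = x0" "v 0 = v0"
    by (rule strong_solution_weak[OF strong[OF S(1)]])

  \<comment> \<open>The solution from \<open>Tstop\<close> on\<close>
  have v_late: "v t = 0" if "t \<ge> Tstop" for t
  proof -
    \<comment> \<open>The infimum only gives rest strictly after \<open>Tstop\<close>; continuity of
      \<open>v\<close> adds the time \<open>Tstop\<close> itself.\<close>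
    have "v Tstop = 0"
    proof (rule continuous_constant_on_closure[of "{Tstop<..<S}" v 0])
      have "closure {Tstop<..<S} = {Tstop..S}" by (rule closure_greaterThanLessThan) (simp add: S_def)
      then show "continuous_on (closure {Tstop<..<S}) v" "Tstop \<in> closure {Tstop<..<S}"
        using ws(1) stop(2) S by (auto simp: weak_solution_def intro: continuous_on_subset)
      show "v t = 0" if "t \<in> {Tstop<..<S}" for t using stop_time_zero[OF stop(1)] that by auto
    qed
    then show ?thesis using stop_time_zero[OF stop(1), of t] that by (cases "t = Tstop") auto
  qed
  have x_late: "x t = x Tstop" if t: "t \<ge> Tstop" for t
  proof -
    \<comment> \<open>As \<open>t\<close> may exceed \<open>S\<close>, a solution on a longer
      interval is taken. Testing with \<open>x t - x Tstop\<close> makes its squared norm an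
      integral of zero.\<close>
    have "t + 1 > 0" using t stop(2) by simp
    then obtain v' n N where "weak_solution (t + 1) x v v' n N"
      using strong_solution_weak[OF strong] by blast
    then have "((\<lambda>\<tau>. v \<tau> \<bullet> (x t - x Tstop)) has_integral (x t - x Tstop) \<bullet> (x t - x Tstop)) {Tstop..t}"
      using t stop(2) by (intro weak_primitiveD) (auto simp: weak_solution_def)
    moreover have "((\<lambda>\<tau>. v \<tau> \<bullet> (x t - x Tstop)) has_integral 0) {Tstop..t}"
      using v_late by (intro has_integral_is_0) auto
    ultimately have "(x t - x Tstop) \<bullet> (x t - x Tstop) = 0" by (rule has_integral_unique)
    then show ?thesis by simp
  qed
  obtain C where C: "C > 0" and err: "\<And>h X V t. 0 < h \<Longrightarrow> h \<le> 1 \<Longrightarrow>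
      discrete_scheme gradf \<phi> \<gamma> \<beta> x0 v0 h X V \<Longrightarrow> 0 \<le> t \<Longrightarrow> t \<le> S \<Longrightarrow>
      norm (interp_x h X V t - x t) \<le> C * sqrt h \<and> norm (interp_v h V t - v t) \<le> C * sqrt h"
    using scheme_error[OF ws less_imp_le[OF S(1)] \<xi>0] by fastforce
  \<comment> \<open>The factor in the time \<open>c * sqrt h\<close> needed to lose a speed
    \<open>C * sqrt h\<close> at rate \<open>d\<close>.\<close>
  define c where "c = C / d"
  \<comment> \<open>A bound for \<open>sqrt h\<close>. The three terms ensure that
    \<open>h \<le> sqrt h\<close>, that the scheme stops before \<open>S\<close>, and that the force
    stays within \<open>d\<close> of \<open>G0\<close>; the added 1 keeps the last denominator
    positive.\<close>
  define \<epsilon> where "\<epsilon> = min 1 (min (1 / (2 + c)) (d / (L * ((2 + \<beta>) * C) + 1)))"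
  have c: "c > 0" using C d by (simp add: c_def)
  have LC: "0 \<le> L * ((2 + \<beta>) * C)" using L \<beta> C by simp
  then have \<epsilon>: "\<epsilon> > 0" using c d by (simp add: \<epsilon>_def add_nonneg_pos)
  have core: "\<exists>K. stop_index (V h) = enat K \<and> \<bar>h * real K - Tstop\<bar> \<le> (2 + c) * sqrt h \<and>
      norm (X h K - x Tstop) \<le> C * sqrt h \<and>
      (\<forall>t\<ge>0. norm (interp_x h (X h) (V h) t - x t) + norm (interp_v h (V h) t - v t) \<le> 2 * C * sqrt h)"
    if h: "0 < h" "h \<le> \<epsilon>\<^sup>2" for h
  proof -
    define \<rho> where "\<rho> = sqrt h"
    have \<rho>: "\<rho> > 0" "\<rho> \<le> \<epsilon>" using h \<epsilon> by (auto simp: \<rho>_def intro: real_le_lsqrt)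
    have "\<rho> \<le> 1" using \<rho> by (simp add: \<epsilon>_def)
    then have h_le: "h \<le> \<rho>" "h \<le> 1" using h \<rho> mult_left_mono[of \<rho> 1 \<rho>] by (auto simp: \<rho>_def)
    have \<rho>c: "(2 + c) * \<rho> \<le> 1"
    proof -
      have "\<rho> \<le> 1 / (2 + c)" using \<rho> by (simp add: \<epsilon>_def)
      then show ?thesis using c by (simp add: field_simps)
    qed
    have \<rho>L: "L * ((2 + \<beta>) * (C * \<rho>)) \<le> d"
    proof -
      have "\<rho> \<le> d / (L * ((2 + \<beta>) * C) + 1)" using \<rho> by (simp add: \<epsilon>_def)
      then have "(L * ((2 + \<beta>) * C) + 1) * \<rho> \<le> d" using LC by (simp add: field_simps)
      then show ?thesis using \<rho> by (simp add: algebra_simps)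
    qed
    \<comment> \<open>The position may be off by twice the error because the solution is later
      compared with \<open>x Tstop\<close> by way of the stopped scheme.\<close>
    have near: "norm (gradf (y + \<beta> *\<^sub>R w) - G0) \<le> d"
      if "norm (y - x Tstop) \<le> 2 * (C * \<rho>)" "norm w \<le> C * \<rho>" for y w
    proof -
      have "norm (y + \<beta> *\<^sub>R w - x Tstop) \<le> norm (y - x Tstop) + norm (\<beta> *\<^sub>R w)"
        using norm_triangle_ineq[of "y - x Tstop" "\<beta> *\<^sub>R w"] by (simp add: algebra_simps)
      also have "\<dots> \<le> 2 * (C * \<rho>) + \<beta> * (C * \<rho>)"
        using that \<beta> by (intro add_mono) (auto intro: mult_left_mono)
      also have "\<dots> = (2 + \<beta>) * (C * \<rho>)" by (simp add: distrib_right)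
      finally have "L * norm (y + \<beta> *\<^sub>R w - x Tstop) \<le> L * ((2 + \<beta>) * (C * \<rho>))"
        using L by (rule mult_left_mono)
      then show ?thesis
        using F_lip[of "y + \<beta> *\<^sub>R w" "x Tstop"] \<rho>L by (simp add: G0_def)
    qed
    note sch = scheme[OF h(1)] h(1)
    let ?X = "X h" and ?V = "V h"
    have node: "norm (?X k - x (real k * h)) \<le> C * \<rho>" "norm (?V k - v (real k * h)) \<le> C * \<rho>"
      if "real k * h \<le> S" for k
      using err[OF h(1) h_le(2) sch(1), of "real k * h"] that h(1)
        interp_x_eq[OF sch, of k "real k * h"] interp_v_eq[OF h(1), of k "real k * h" ?V]
      by (simp_all add: \<rho>_def)
    have late: "norm (?X k - x Tstop) \<le> C * \<rho>" "norm (?V k) \<le> C * \<rho>"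
      if "Tstop \<le> real k * h" "real k * h \<le> S" for k
      using node[OF that(2)] x_late[OF that(1)] v_late[OF that(1)] by simp_all

    \<comment> \<open>Upper bound for the stopping index\<close>
    define m where "m = nat \<lceil>Tstop / h\<rceil>"
    \<comment> \<open>\<open>m\<close> is the first node at or after \<open>Tstop\<close>;
      \<open>i\<close> steps, each removing \<open>h * d\<close>, exhaust the speed
      \<open>C * \<rho>\<close> that may remain there.\<close>
    define i where "i = nat \<lceil>C * \<rho> / (h * d)\<rceil>"
    define J where "J = m + i"
    have m: "Tstop \<le> real m * h" "real m * h \<le> Tstop + h"
    proof -
      have "Tstop / h \<le> real m" "real m \<le> Tstop / h + 1"
        using stop(2) h(1) by (auto simp: m_def intro: of_int_ceiling_le_add_one)
      then show "Tstop \<le> real m * h" "real m * h \<le> Tstop + h"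
        using h(1) by (simp_all add: field_simps)
    qed
    have i: "C * \<rho> \<le> real i * (h * d)" "real i * h \<le> c * \<rho> + h"
    proof -
      have "C * \<rho> / (h * d) \<le> real i" "real i \<le> C * \<rho> / (h * d) + 1"
        using C \<rho> d h(1) by (auto simp: i_def intro: of_int_ceiling_le_add_one)
      then show "C * \<rho> \<le> real i * (h * d)" "real i * h \<le> c * \<rho> + h"
        using h(1) d by (simp_all add: c_def field_simps)
    qed
    \<comment> \<open>Rounding up in \<open>m\<close> and in \<open>i\<close> costs one
      \<open>h\<close> each, and \<open>h \<le> \<rho>\<close>.\<close>
    have J: "real J * h \<le> Tstop + (2 + c) * \<rho>"
      using m(2) i(2) h_le by (simp add: J_def algebra_simps)
    then have J_S: "real J * h \<le> S" using \<rho>c by (simp add: S_def)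
    have T_J: "Tstop \<le> real J * h" using m(1) h(1) by (simp add: J_def distrib_right add_increasing2)
    have in_window: "Tstop \<le> real k * h" "real k * h \<le> S" if "m \<le> k" "k \<le> J" for k
    proof -
      have "real m * h \<le> real k * h" "real k * h \<le> real J * h"
        using that h(1) by (auto intro!: mult_right_mono)
      then show "Tstop \<le> real k * h" "real k * h \<le> S" using m(1) J_S by linarith+
    qed
    have C\<rho>: "C * \<rho> \<le> 2 * (C * \<rho>)" using C \<rho> by simp
    have VJ: "?V J = 0"
      unfolding J_def
    proof (rule scheme_extinction[OF sch margin'])
      show "norm (?V m) \<le> real i * (h * d)"
        using late(2)[of m] in_window[of m] i(1) by (simp add: J_def)
      show "norm (gradf (?X k + \<beta> *\<^sub>R ?V k) - G0) \<le> d" if "m \<le> k" "k < m + i" for k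
        using late[of k] in_window[of k] that C\<rho> by (intro near) (auto simp: J_def)
    qed
    have "norm (gradf (?X J) - G0) \<le> d"
      using near[of "?X J" 0] late(1)[OF T_J J_S] C\<rho> C \<rho> by simp
    note stopped = scheme_stopped[OF sch margin' this VJ]
    have "\<forall>k\<ge>J. ?V k = 0" using stopped by (metis le_Suc_ex)
    then obtain K where K: "stop_index ?V = enat K" and VK: "\<forall>k\<ge>K. ?V k = 0" and KJ: "K \<le> J"
      by (rule stop_index_eq)
    have XK: "?X k = ?X K" if "K \<le> k" for k
      using that
    proof (induction k rule: dec_induct)
      case (step k)
      then show ?case using scheme_X[OF sch, of k] VK by simp
    qed simp
    \<comment> \<open>\<open>K\<close> may precede \<open>Tstop\<close>, but \<open>X K\<close>
      equals \<open>X J\<close>, and the node \<open>J\<close> lies in the window after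
      \<open>Tstop\<close>.\<close>
    have XK_err: "norm (?X K - x Tstop) \<le> C * \<rho>"
      using late(1)[OF T_J J_S] XK[OF KJ] by simp
    have KJh: "real K * h \<le> real J * h" using KJ h(1) by simp
    have interp: "interp_x h ?X ?V t = ?X K" "interp_v h ?V t = 0" if "real K * h \<le> t" for t
    proof -
      have "real K \<le> t / h" using that h(1) by (simp add: field_simps)
      then have k: "K \<le> nat \<lfloor>t / h\<rfloor>" by (rule le_nat_floor)
      then have "?V (nat \<lfloor>t / h\<rfloor>) = 0" "?V (Suc (nat \<lfloor>t / h\<rfloor>)) = 0" using VK by auto
      then show "interp_x h ?X ?V t = ?X K" "interp_v h ?V t = 0"
        using XK[OF k] by (simp_all add: interp_x_def interp_v_def pw_affine_def Let_def)
    qed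

    \<comment> \<open>Lower bound for the stopping index\<close>
    have lower: "Tstop - real K * h \<le> c * \<rho>"
    proof (cases "Tstop \<le> real K * h")
      case True
      then show ?thesis using c \<rho> by (smt (verit) mult_pos_pos)
    next
      case False
      let ?s = "real K * h"
      have s0: "0 \<le> ?s" using h(1) by simp
      \<comment> \<open>From \<open>?s\<close> on the interpolants are constant, so the error
        estimate bounds the speed of the solution and its distance to \<open>X K\<close>
        simultaneously.\<close>
      have late': "norm (x t - x Tstop) \<le> 2 * (C * \<rho>)" "norm (v t) \<le> C * \<rho>"
        if t: "?s \<le> t" "t \<le> S" for t
      proof -
        have e: "norm (?X K - x t) \<le> C * \<rho>" "norm (v t) \<le> C * \<rho>"
          using err[OF h(1) h_le(2) sch(1) order_trans[OF s0 t(1)] t(2)] interp[OF t(1)]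
          by (simp_all add: \<rho>_def)
        then show "norm (v t) \<le> C * \<rho>" by simp
        have "norm (x t - x Tstop) \<le> norm (x t - ?X K) + norm (?X K - x Tstop)"
          using norm_triangle_ineq[of "x t - ?X K" "?X K - x Tstop"] by simp
        then show "norm (x t - x Tstop) \<le> 2 * (C * \<rho>)"
          using e(1) XK_err by (simp add: norm_minus_commute)
      qed
      have near': "norm (gradf (x t + \<beta> *\<^sub>R v t) - G0) \<le> d" if "?s \<le> t" "t \<le> Tstop" for t
        using late'[of t] that S(2) by (intro near) auto
      \<comment> \<open>A zero of \<open>v\<close> before \<open>Tstop\<close> would persist up to
        \<open>Tstop\<close> and beyond, contradicting the minimality of the stopping time. This
        provides the premise of the linear decay.\<close>
      have moving: "v t \<noteq> 0" if t: "?s \<le> t" "t < Tstop" for t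
      proof
        assume vt: "v t = 0"
        have "v u = 0" if "t \<le> u" for u
        proof (cases "u \<le> Tstop")
          case True
          show ?thesis
            by (rule weak_solution_stopped[OF ws(1) _ that _ margin' near' vt])
              (use t s0 True S(2) in auto)
        qed (use v_late in auto)
        then show False using stop_time_minimal[OF stop(1), of t] t s0 by auto
      qed
      have bound: "t - ?s \<le> c * \<rho>" if t: "?s \<le> t" "t < Tstop" for t
      proof -
        have "norm (v t) \<le> norm (v ?s) - d * (t - ?s)"
          by (rule weak_solution_decay[OF ws(1) s0 t(1) _ margin' near' moving])
            (use t S(2) in auto)
        then have "d * (t - ?s) \<le> C * \<rho>"
          using late'(2)[of ?s] False S(2) norm_ge_zero[of "v t"] by linarith
        then show ?thesis using d by (simp add: c_def field_simps)
      qed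
      \<comment> \<open>The decay bound holds only strictly before \<open>Tstop\<close>, where
        \<open>v\<close> does not vanish; an intermediate time closes the gap.\<close>
      show ?thesis
      proof (rule ccontr)
        assume "\<not> ?thesis"
        then have "?s + c * \<rho> < Tstop" by simp
        then obtain t where t: "?s + c * \<rho> < t" "t < Tstop" using dense by blast
        moreover have "0 < c * \<rho>" using c \<rho> by simp
        ultimately show False using bound[of t] by linarith
      qed
    qed
    have 1: "\<bar>h * real K - Tstop\<bar> \<le> (2 + c) * \<rho>"
      using lower J KJh \<rho> by (simp add: abs_le_iff algebra_simps)
    have 2: "norm (interp_x h ?X ?V t - x t) + norm (interp_v h ?V t - v t) \<le> 2 * C * \<rho>"
      if t: "t \<ge> 0" for t
    proof (cases "t \<le> S")
      case True
      then show ?thesis using err[OF h(1) h_le(2) sch(1) t True] by (simp add: \<rho>_def)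
    next
      case False
      then have "real K * h \<le> t" "Tstop \<le> t" using KJh J_S S(2) by linarith+
      then show ?thesis using interp[of t] x_late[of t] v_late[of t] XK_err C\<rho> by simp
    qed
    show ?thesis using K 1 XK_err 2 unfolding \<rho>_def by blast
  qed

  \<comment> \<open>A common constant and the limits as \<open>h\<close> tends to 0\<close>
  define C' where "C' = 2 + c + 3 * C"
  have C': "C' > 0" using c C by (simp add: C'_def)
  have rate: "stop_index (V h) < \<infinity> \<and>
       \<bar>h * real (the_enat (stop_index (V h))) - Tstop\<bar>
         + norm (X h (the_enat (stop_index (V h))) - x Tstop) \<le> C' * sqrt h \<and>
       (SUP t\<in>{0..}. ereal (norm (interp_x h (X h) (V h) t - x t)
                             + norm (interp_v h (V h) t - v t))) \<le> ereal (C' * sqrt h)"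
    if h: "0 < h" "h \<le> \<epsilon>\<^sup>2" for h
  proof -
    obtain K where K: "stop_index (V h) = enat K" "\<bar>h * real K - Tstop\<bar> \<le> (2 + c) * sqrt h"
      "norm (X h K - x Tstop) \<le> C * sqrt h"
      "\<And>t. t \<ge> 0 \<Longrightarrow> norm (interp_x h (X h) (V h) t - x t) + norm (interp_v h (V h) t - v t) \<le> 2 * C * sqrt h"
      using core[OF h] by blast
    have le: "2 * C * sqrt h \<le> C' * sqrt h" "(2 + c) * sqrt h + C * sqrt h \<le> C' * sqrt h"
      using h c C unfolding distrib_right[symmetric] by (auto intro!: mult_right_mono simp: C'_def)
    have "(SUP t\<in>{0..}. ereal (norm (interp_x h (X h) (V h) t - x t)
            + norm (interp_v h (V h) t - v t))) \<le> ereal (C' * sqrt h)"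
      using K(4) le(1) by (intro SUP_least) (auto intro: order_trans)
    then show ?thesis using K(1-3) le(2) by simp
  qed
  have \<epsilon>2: "\<epsilon>\<^sup>2 > 0" using \<epsilon> by simp
  have "\<forall>\<^sub>F h in at_right 0. stop_index (V h) < \<infinity>"
    using rate \<epsilon>2 by (intro eventually_at_rightI[of 0 "\<epsilon>\<^sup>2"]) auto
  moreover have "((\<lambda>h. h * real (the_enat (stop_index (V h)))) \<longlongrightarrow> Tstop) (at_right 0)"
  proof (rule tendsto_sqrt_rate[OF \<epsilon>2])
    fix h :: real assume "0 < h" "h \<le> \<epsilon>\<^sup>2"
    from rate[OF this] show "norm (h * real (the_enat (stop_index (V h))) - Tstop) \<le> C' * sqrt h"
      using norm_ge_zero[of "X h (the_enat (stop_index (V h))) - x Tstop"] by (simp del: norm_ge_zero)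
  qed
  moreover have "((\<lambda>h. X h (the_enat (stop_index (V h)))) \<longlongrightarrow> x Tstop) (at_right 0)"
  proof (rule tendsto_sqrt_rate[OF \<epsilon>2])
    fix h :: real assume "0 < h" "h \<le> \<epsilon>\<^sup>2"
    from rate[OF this] show "norm (X h (the_enat (stop_index (V h))) - x Tstop) \<le> C' * sqrt h"
      by linarith
  qed
  ultimately show ?thesis using rate C' \<epsilon>2 by blast
qed

end
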